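(* Let $G$ be a locally compact group, $\mathcal{H}$ a Hilbert space and $\pi:G\to\mathcal{U}(\mathcal{H})$ a strongly continuous unitary representation. The following are equivalent: (i) $\pi$ is norm continuous (i.e. continuous when $\mathcal{U}(\mathcal{H})$ carries the operator norm topology). (ii) $\Gamma_\pi(\mathrm{L}^1(G))\subset \mathrm{C}^*_\pi\otimes^h\mathrm{C}^*_\pi$. (iii) There is an $f\in \mathrm{L}^1(G)\setminus \mathrm{I}_0(G)$ such that $\Gamma_\pi(f)\in \mathrm{C}^*_\pi\otimes^h\mathrm{C}^*_\pi$.
   Context: $\mathcal{U}(\mathcal{H})$ is the unitary group of $\mathcal{B}(\mathcal{H})$. $\mathrm{M}(G)$ is the Banach algebra (under convolution) of bounded complex regular Borel measures on $G$, i.e. the dual of $\mathcal{C}_0(G)$; $\mathrm{L}^1(G)$ is identified with the ideal of measures absolutely continuous with respect to left Haar measure $ds$. The augmentation ideal is $\mathrm{I}_0(G)=\{f\in\mathrm{L}^1(G):\int_G f(s)\,ds=0\}$. For $\mu\in\mathrm{M}(G)$, $\pi_1(\mu)=\int_G\pi(s)\,d\mu(s)\in\mathcal{B}(\mathcal{H})$ (weak* convergent integral), and $\mathrm{C}^*_\pi$ is the norm closure of $\pi_1(\mathrm{L}^1(G))$ in $\mathcal{B}(\mathcal{H})$, a C*-algebra. For closed subspaces $\mathcal{V},\mathcal{W}$ of $\mathcal{B}(\mathcal{H})$, the extended Haagerup tensor product $\mathcal{V}\otimes^{eh}\mathcal{W}$ is the space of formal series $T=\sum_{i\in I}v_i\otimes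 w_i$ with $v_i\in\mathcal{V}$, $w_i\in\mathcal{W}$, such that $\sum_i v_iv_i^*$ and $\sum_i w_i^*w_i$ converge weak* in $\mathcal{B}(\mathcal{H})$; two series are identified if they define the same map $x\mapsto\sum_i v_ixw_i$ on $\mathcal{B}(\mathcal{H})$. Norm: $\|T\|_{eh}=\inf\|\sum_i v_iv_i^*\|^{1/2}\|\sum_i w_i^*w_i\|^{1/2}$ over all representations of $T$. Elements are identified with the maps $x\mapsto \sum_i v_ixw_i$; in this way $\mathcal{B}(\mathcal{H})\otimes^{eh}\mathcal{B}(\mathcal{H})$ is identified isometrically with the space of normal completely bounded maps on $\mathcal{B}(\mathcal{H})$. The Haagerup tensor product $\mathcal{V}\otimes^h\mathcal{W}$ is the set of $T\in\mathcal{V}\otimes^{eh}\mathcal{W}$ admitting a representation $T=\sum_i v_i\otimes w_i$ ($v_i\in\mathcal{V}$, $w_i\in\mathcal{W}$) for which $\sum_i v_iv_i^*$ and $\sum_i w_i^*w_i$ converge in norm. For $\mu\in\mathrm{M}(G)$, $\Gamma_\pi(\mu)=\int_G\pi(s)\otimes\pi(s)^*\,d\mu(s)\in\mathcal{B}(\mathcal{H})\otimes^{eh}\mathcal{B}(\mathcal{H})$, the integral converging weak* with respect to the duality $\mathcal{B}(\mathcal{H})\otimes^{eh}\mathcal{B}(\mathcal{H})\cong(\mathcal{B}(\mathcal{H})_*\otimes^h\mathcal{B}(\mathcal{H})_* )^*$ given by $\langle\sum_i v_i\otimes w_i,\omega\otimes\nu\rangle=\sum_i\omega(v_i)\nu(w_i)$.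 As a map, $\Gamma_\pi(\mu)x=\int_G\pi(s)x\pi(s)^*\,d\mu(s)$ (weak* integral) for $x\in\mathcal{B}(\mathcal{H})$. *)

theory Defs
  imports "HOL-Analysis.Analysis"
begin

section \<open>Complex Hilbert spaces\<close>

text \<open>Completeness comes from the superclass \<^class>\<open>banach\<close>.  Positive definiteness of the inner
  product is a consequence of the last axiom, since \<^const>\<open>sqrt\<close> is an odd bijection and the norm
  is positive definite.  The inner product is linear in its first argument.\<close>

class complex_hilbert_space = banach +
  fixes scaleC :: "complex \<Rightarrow> 'a \<Rightarrow> 'a"  (infixr \<open>*\<^sub>C\<close> 75)
    and cinner :: "'a \<Rightarrow> 'a \<Rightarrow> complex"
  assumes scaleC_of_real: "complex_of_real r *\<^sub>C x = r *\<^sub>R x"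
    and scaleC_add_right: "c *\<^sub>C (x + y) = c *\<^sub>C x + c *\<^sub>C y"
    and scaleC_add_left: "(c + d) *\<^sub>C x = c *\<^sub>C x + d *\<^sub>C x"
    and scaleC_scaleC: "c *\<^sub>C d *\<^sub>C x = (c * d) *\<^sub>C x"
    and cinner_add_left: "cinner (x + y) z = cinner x z + cinner y z"
    and cinner_scaleC_left: "cinner (c *\<^sub>C x) y = c * cinner x y"
    and cinner_commute: "cinner x y = cnj (cinner y x)"
    and norm_eq_sqrt_cinner: "norm x = sqrt (Re (cinner x x))"

lemma cinner_self_eq_norm:
  fixes x :: "'a::complex_hilbert_space"
  shows "cinner x x = complex_of_real ((norm x)\<^sup>2)"
proof -
  have im: "Im (cinner x x) = 0"
    using arg_cong[OF cinner_commute[of x x], of Im] by simp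
  have "sqrt (Re (cinner x x)) \<ge> 0"
    by (metis norm_eq_sqrt_cinner norm_ge_zero)
  hence "Re (cinner x x) = (norm x)\<^sup>2"
    by (simp add: norm_eq_sqrt_cinner)
  with im show ?thesis
    by (simp add: complex_eq_iff)
qed

instantiation complex :: complex_hilbert_space
begin

definition "scaleC (c::complex) (x::complex) = c * x"

definition "cinner (x::complex) (y::complex) = x * cnj y"

instance
  by standard
    (auto simp: scaleC_complex_def cinner_complex_def algebra_simps scaleR_conv_of_real
      cmod_def power2_eq_square)

end

section \<open>Bounded operators and the weak* topology\<close>

text \<open>Elements of \<^typ>\<open>'h \<Rightarrow>\<^sub>L 'h\<close> are only real-linear, so $B(H)$ is the closed subset of the
  complex-linear ones; the norm there is the operator norm.\<close>

definition bounded_ops :: "('h::complex_hilbert_space \<Rightarrow>\<^sub>L 'h) set" where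
  "bounded_ops = {T. \<forall>c x. blinfun_apply T (c *\<^sub>C x) = c *\<^sub>C blinfun_apply T x}"

definition adj :: "('h::complex_hilbert_space \<Rightarrow>\<^sub>L 'h) \<Rightarrow> ('h \<Rightarrow>\<^sub>L 'h)" where
  "adj T = (THE S. S \<in> bounded_ops \<and>
     (\<forall>x y. cinner (blinfun_apply T x) y = cinner x (blinfun_apply S y)))"

definition unitary_ops :: "('h::complex_hilbert_space \<Rightarrow>\<^sub>L 'h) set" where
  "unitary_ops = {U \<in> bounded_ops. adj U o\<^sub>L U = id_blinfun \<and> U o\<^sub>L adj U = id_blinfun}"

text \<open>The predual of $B(H)$: the functionals $T \mapsto \mathrm{tr}(T\rho)$ with $\rho$ of trace
  class, each such $\rho$ being a sum of rank-one operators with square-summable coefficient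
  vectors.\<close>

definition predual :: "(('h::complex_hilbert_space \<Rightarrow>\<^sub>L 'h) \<Rightarrow> complex) set" where
  "predual = {\<omega>. \<exists>x y :: nat \<Rightarrow> 'h.
     summable (\<lambda>n. (norm (x n))\<^sup>2) \<and> summable (\<lambda>n. (norm (y n))\<^sup>2) \<and>
     \<omega> = (\<lambda>T. \<Sum>n. cinner (blinfun_apply T (x n)) (y n))}"

definition wstar_has_sum ::
    "('i \<Rightarrow> ('h::complex_hilbert_space \<Rightarrow>\<^sub>L 'h)) \<Rightarrow> ('h \<Rightarrow>\<^sub>L 'h) \<Rightarrow> 'i set \<Rightarrow> bool" where
  "wstar_has_sum F A I \<longleftrightarrow>
     A \<in> bounded_ops \<and> (\<forall>\<omega>\<in>predual. ((\<lambda>i. \<omega> (F i)) has_sum \<omega> A) I)"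

text \<open>The weak* integral of \<open>F\<close> against the complex measure \<open>f dM\<close>.\<close>

definition wstar_integral ::
    "'g measure \<Rightarrow> ('g \<Rightarrow> complex) \<Rightarrow> ('g \<Rightarrow> ('h::complex_hilbert_space \<Rightarrow>\<^sub>L 'h)) \<Rightarrow> ('h \<Rightarrow>\<^sub>L 'h)" where
  "wstar_integral M f F = (THE A. A \<in> bounded_ops \<and>
     (\<forall>\<omega>\<in>predual. integrable M (\<lambda>s. \<omega> (F s) * f s) \<and> \<omega> A = (LINT s|M. \<omega> (F s) * f s)))"

section \<open>Extended Haagerup and Haagerup tensor products\<close>

text \<open>The formal series $\sum_{i\in I} v_i \otimes w_i$ is admissible for the extended Haagerup
  tensor product of \<open>V\<close> and \<open>W\<close>, and \<open>T\<close> is the map $x \mapsto \sum_i v_i x w_i$ on $B(H)$ that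
  it defines.\<close>

definition eh_series ::
    "('h::complex_hilbert_space \<Rightarrow>\<^sub>L 'h) set \<Rightarrow> ('h \<Rightarrow>\<^sub>L 'h) set \<Rightarrow> 'i set \<Rightarrow>
     ('i \<Rightarrow> ('h \<Rightarrow>\<^sub>L 'h)) \<Rightarrow> ('i \<Rightarrow> ('h \<Rightarrow>\<^sub>L 'h)) \<Rightarrow> (('h \<Rightarrow>\<^sub>L 'h) \<Rightarrow> ('h \<Rightarrow>\<^sub>L 'h)) \<Rightarrow> bool" where
  "eh_series V W I v w T \<longleftrightarrow>
     (\<forall>i\<in>I. v i \<in> V \<and> w i \<in> W) \<and>
     (\<exists>A. wstar_has_sum (\<lambda>i. v i o\<^sub>L adj (v i)) A I) \<and>
     (\<exists>B. wstar_has_sum (\<lambda>i. adj (w i) o\<^sub>L w i) B I) \<and>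
     T \<in> bounded_ops \<rightarrow>\<^sub>E bounded_ops \<and>
     (\<forall>x\<in>bounded_ops. wstar_has_sum (\<lambda>i. v i o\<^sub>L x o\<^sub>L w i) (T x) I)"

text \<open>Series are identified when they define the same map, so the tensor products are sets of
  maps on $B(H)$ (extensional outside \<^const>\<open>bounded_ops\<close>).  Drawing the index sets from
  \<^typ>\<open>'h \<times> nat\<close> is no restriction: if $\sum_i v_i v_i^*$ converges weak*, then for each vector $\xi$
  only countably many $i$ satisfy $v_i^*\xi \neq 0$, hence the set of $i$ with $v_i \neq 0$ injects
  into \<^typ>\<open>'h \<times> nat\<close>, and the remaining terms can be dropped.\<close>

definition ext_haagerup_tensor ::
    "('h::complex_hilbert_space \<Rightarrow>\<^sub>L 'h) set \<Rightarrow> ('h \<Rightarrow>\<^sub>L 'h) set \<Rightarrow> (('h \<Rightarrow>\<^sub>L 'h) \<Rightarrow> ('h \<Rightarrow>\<^sub>L 'h)) set"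
    (infixr \<open>\<otimes>eh\<close> 70) where
  "V \<otimes>eh W = {T. \<exists>(I :: ('h \<times> nat) set) v w. eh_series V W I v w T}"

definition haagerup_tensor ::
    "('h::complex_hilbert_space \<Rightarrow>\<^sub>L 'h) set \<Rightarrow> ('h \<Rightarrow>\<^sub>L 'h) set \<Rightarrow> (('h \<Rightarrow>\<^sub>L 'h) \<Rightarrow> ('h \<Rightarrow>\<^sub>L 'h)) set"
    (infixr \<open>\<otimes>h\<close> 70) where
  "V \<otimes>h W = {T \<in> V \<otimes>eh W. \<exists>(I :: ('h \<times> nat) set) v w. eh_series V W I v w T \<and>
     (\<lambda>i. v i o\<^sub>L adj (v i)) summable_on I \<and>
     (\<lambda>i. adj (w i) o\<^sub>L w i) summable_on I}"

section \<open>Group algebra and representations\<close>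

text \<open>Groups are written additively but \<^class>\<open>topological_group_add\<close> does not assume
  commutativity: \<open>s + t\<close>, \<open>0\<close> and \<open>- s\<close> are the product, the identity and the inverse.\<close>

definition left_haar_measure :: "'g::{topological_group_add,t2_space} measure \<Rightarrow> bool" where
  "left_haar_measure M \<longleftrightarrow>
     sets M = sets borel \<and>
     emeasure M UNIV \<noteq> 0 \<and>
     (\<forall>s. \<forall>A\<in>sets borel. emeasure M ((\<lambda>t. s + t) ` A) = emeasure M A) \<and>
     (\<forall>K. compact K \<longrightarrow> emeasure M K < \<infinity>) \<and>
     (\<forall>A\<in>sets borel. emeasure M A = (INF U\<in>{U. open U \<and> A \<subseteq> U}. emeasure M U)) \<and>
     (\<forall>U. open U \<longrightarrow> emeasure M U = (SUP K\<in>{K. compact K \<and> K \<subseteq> U}. emeasure M K))"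

definition L1 :: "'g measure \<Rightarrow> ('g \<Rightarrow> complex) set" where
  "L1 M = {f. integrable M f}"

definition augmentation_ideal :: "'g measure \<Rightarrow> ('g \<Rightarrow> complex) set" where
  "augmentation_ideal M = {f \<in> L1 M. (LINT s|M. f s) = 0}"

definition unitary_rep ::
    "('g::{topological_group_add,t2_space} \<Rightarrow> ('h::complex_hilbert_space \<Rightarrow>\<^sub>L 'h)) \<Rightarrow> bool" where
  "unitary_rep \<pi> \<longleftrightarrow> (\<forall>s. \<pi> s \<in> unitary_ops) \<and> (\<forall>s t. \<pi> (s + t) = \<pi> s o\<^sub>L \<pi> t)"

definition strongly_continuous ::
    "('g::topological_space \<Rightarrow> ('h::complex_hilbert_space \<Rightarrow>\<^sub>L 'h)) \<Rightarrow> bool" where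
  "strongly_continuous \<pi> \<longleftrightarrow> (\<forall>\<xi>. continuous_on UNIV (\<lambda>s. blinfun_apply (\<pi> s) \<xi>))"

definition norm_continuous ::
    "('g::topological_space \<Rightarrow> ('h::complex_hilbert_space \<Rightarrow>\<^sub>L 'h)) \<Rightarrow> bool" where
  "norm_continuous \<pi> \<longleftrightarrow> continuous_on UNIV \<pi>"

definition pi1 ::
    "'g measure \<Rightarrow> ('g \<Rightarrow> ('h::complex_hilbert_space \<Rightarrow>\<^sub>L 'h)) \<Rightarrow> ('g \<Rightarrow> complex) \<Rightarrow> ('h \<Rightarrow>\<^sub>L 'h)" where
  "pi1 M \<pi> f = wstar_integral M f \<pi>"

definition Cstar ::
    "'g measure \<Rightarrow> ('g \<Rightarrow> ('h::complex_hilbert_space \<Rightarrow>\<^sub>L 'h)) \<Rightarrow> ('h \<Rightarrow>\<^sub>L 'h) set" where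
  "Cstar M \<pi> = closure (pi1 M \<pi> ` L1 M)"

text \<open>$\int f(s)\,\pi(s)\otimes\pi(s)^*\,ds$ as a map on $B(H)$.  On the rank-one operator
  $x = \langle\cdot,\theta\rangle\xi$, the coefficient $\langle T(x)\zeta,\eta\rangle$ of the map of
  a tensor \<open>T\<close> is the pairing of \<open>T\<close> with
  $\langle\cdot\,\xi,\eta\rangle\otimes\langle\cdot\,\zeta,\theta\rangle$; so this map determines, and is
  determined by, the integral in the weak* topology of the extended Haagerup tensor product.\<close>

definition Gamma_rep ::
    "'g measure \<Rightarrow> ('g \<Rightarrow> ('h::complex_hilbert_space \<Rightarrow>\<^sub>L 'h)) \<Rightarrow> ('g \<Rightarrow> complex) \<Rightarrow>
     (('h \<Rightarrow>\<^sub>L 'h) \<Rightarrow> ('h \<Rightarrow>\<^sub>L 'h))" where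
  "Gamma_rep M \<pi> f = (\<lambda>x\<in>bounded_ops. wstar_integral M f (\<lambda>s. \<pi> s o\<^sub>L x o\<^sub>L adj (\<pi> s)))"

end

theory Submission
  imports Defs
begin

text \<open>Write $\Gamma = \Gamma_\pi(f)$.

  From (iii) to (i): evaluating $\Gamma = \sum_i v_i \otimes w_i$ at the identity gives
  $\sum_i v_i w_i = (\int f)\,1$, and for an element of the Haagerup tensor product this series
  converges in norm.  The operators $A$ for which $s \mapsto \pi(s)A$ is norm continuous form a
  closed right ideal; it contains $C^*_\pi$, because translation is continuous in $L^1(G)$.  Hence
  it contains a nonzero multiple of the identity.

  From (i) to (ii): norm continuity puts every $\pi(s)$ into $C^*_\pi$.  On the support of $f$, which is
  $\sigma$-compact up to a null set, the ranges of $\pi(s)$ and of $\pi(s)^*$ are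
  separable, so $\pi(s) = \sum_i 1_{E_i}(s)\, d_i$ and $\pi(s)^* = \sum_j 1_{E'_j}(s)\, d'_j$ with $d_i, d'_j$ in
  $C^*_\pi$ and uniformly bounded absolute sums.  Integrating,
  $\Gamma = \sum_{i,j} \left(\int f\, 1_{E_i} 1_{E'_j}\right) d_i \otimes d'_j$ converges absolutely.\<close>

section \<open>Hilbert space preliminaries\<close>

text \<open>The Haagerup norm condition enters through a row-column Cauchy-Schwarz inequality: the
  norm of a finite sum of v_i w_i is at most the product of the square roots of the norms of the
  sums of v_i v_i^* and of w_i^* w_i. Norm convergence of those two series therefore forces norm
  convergence of the sum of v_i w_i; weak* convergence would not. In the direction from (i) to (ii)
  the obstacle is size: neither G nor B(H) need be separable, yet an integral of operator pairs has
  to become one series. Two independent partitions are used so that a product of the two expansions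
  involves fixed operators and an indicator; only scalars are left to integrate. Each expansion has
  absolute sum at most 6, so the double series is dominated by 36 |f|. Weak* integrals are handled
  through their matrix coefficients, where scalar integration applies. The operator type is a real
  vector space only, so complex scalars act by composition with \<open>scale_op\<close>.\<close>

lemma cinner_add_right: "cinner x (y + z) = cinner x y + cinner x (z::'a::complex_hilbert_space)"
  by (metis cinner_add_left cinner_commute complex_cnj_add)

lemma cinner_scaleC_right: "cinner x (c *\<^sub>C y) = cnj c * cinner x (y::'a::complex_hilbert_space)"
  by (metis cinner_scaleC_left cinner_commute complex_cnj_mult)

lemma cinner_scaleR_left: "cinner (r *\<^sub>R x) y = of_real r * cinner x (y::'a::complex_hilbert_space)"
  by (metis cinner_scaleC_left scaleC_of_real)

lemma cinner_scaleR_right: "cinner x (r *\<^sub>R y) = of_real r * cinner x (y::'a::complex_hilbert_space)"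
  by (metis cinner_scaleC_right complex_cnj_complex_of_real scaleC_of_real)

lemma cinner_zero_left [simp]: "cinner 0 (y::'a::complex_hilbert_space) = 0"
  using cinner_add_left[of 0 0 y] by simp

lemma cinner_zero_right [simp]: "cinner (y::'a::complex_hilbert_space) 0 = 0"
  using cinner_add_right[of y 0 0] by simp

lemma cinner_minus_left: "cinner (- x) (y::'a::complex_hilbert_space) = - cinner x y"
  using cinner_add_left[of x "-x" y] by (simp add: eq_neg_iff_add_eq_0 add.commute)

lemma cinner_diff_left: "cinner (x - z) (y::'a::complex_hilbert_space) = cinner x y - cinner z y"
  using cinner_add_left[of x "-z" y] by (simp add: cinner_minus_left)

lemma cinner_diff_right: "cinner y (x - (z::'a::complex_hilbert_space)) = cinner y x - cinner y z"
  by (metis cinner_diff_left cinner_commute complex_cnj_diff)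

lemma norm_scaleC: "norm (c *\<^sub>C (x::'a::complex_hilbert_space)) = cmod c * norm x"
proof -
  have "complex_of_real ((norm (c *\<^sub>C x))\<^sup>2) = of_real ((cmod c * norm x)\<^sup>2)"
    by (simp only: cinner_self_eq_norm[symmetric] cinner_scaleC_left cinner_scaleC_right)
      (simp add: cinner_self_eq_norm power_mult_distrib mult.commute[of "cnj c"] complex_norm_square[symmetric])
  hence "(norm (c *\<^sub>C x))\<^sup>2 = (cmod c * norm x)\<^sup>2"
    using of_real_eq_iff by blast
  thus ?thesis by (simp add: power2_eq_iff_nonneg)
qed

lemma norm_add_square:
  fixes x y :: "'a::complex_hilbert_space"
  shows "(norm (x + y))\<^sup>2 = (norm x)\<^sup>2 + 2 * Re (cinner x y) + (norm y)\<^sup>2"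
proof -
  have "(norm (x + y))\<^sup>2 = Re (cinner (x + y) (x + y))"
    by (simp add: cinner_self_eq_norm)
  also have "\<dots> = Re (cinner x x) + Re (cinner x y) + Re (cinner y x) + Re (cinner y y)"
    by (simp add: cinner_add_left cinner_add_right)
  also have "Re (cinner y x) = Re (cinner x y)"
    by (subst cinner_commute) simp
  finally show ?thesis by (simp add: cinner_self_eq_norm)
qed

text \<open>The triangle inequality is part of the norm structure, so expanding its square and
  cancelling already gives the real form of Cauchy-Schwarz.\<close>

lemma Re_cinner_le:
  fixes x y :: "'a::complex_hilbert_space"
  shows "Re (cinner x y) \<le> norm x * norm y"
proof -
  have "(norm (x + y))\<^sup>2 \<le> (norm x + norm y)\<^sup>2"
    by (simp add: norm_triangle_ineq power_mono)
  thus ?thesis by (simp add: norm_add_square power2_sum)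
qed

lemma cinner_norm_le:
  fixes x y :: "'a::complex_hilbert_space"
  shows "cmod (cinner x y) \<le> norm x * norm y"
proof (cases "cinner x y = 0")
  case False
  \<comment> \<open>The phase that rotates \<open>cinner x y\<close> onto the nonnegative real axis,
    so that the bound on real parts applies to \<open>c *\<^sub>C x\<close>.\<close>
  define c where "c = cnj (cinner x y) / cmod (cinner x y)"
  have c: "cmod c = 1" using False by (simp add: c_def norm_divide)
  have "cmod (cinner x y) = Re (c * cinner x y)"
    using False by (simp add: c_def mult.commute[of "cnj _"] power2_eq_square flip: complex_norm_square)
  also have "\<dots> = Re (cinner (c *\<^sub>C x) y)" by (simp add: cinner_scaleC_left)
  also have "\<dots> \<le> norm x * norm y" using Re_cinner_le[of "c *\<^sub>C x" y] c by (simp add: norm_scaleC)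
  finally show ?thesis .
qed simp

lemma cinner_eqI:
  fixes x y :: "'a::complex_hilbert_space"
  assumes "\<And>z. cinner x z = cinner y z"
  shows "x = y"
  using assms[of "x - y"] cinner_self_eq_norm[of "x - y"] by (simp add: cinner_diff_left)

lemma bounded_bilinear_cinner:
  "bounded_bilinear (cinner :: 'a::complex_hilbert_space \<Rightarrow> 'a \<Rightarrow> complex)"
  by standard
    (auto simp: cinner_add_left cinner_add_right cinner_scaleR_left cinner_scaleR_right
      scaleR_conv_of_real intro!: exI[of _ 1] cinner_norm_le)

lemmas continuous_on_cinner [continuous_intros] =
  bounded_bilinear.continuous_on[OF bounded_bilinear_cinner]

text \<open>The representing vector minimises $\|x\|^2 - 2\,\mathrm{Re}\,\varphi(x)$; a minimising
  sequence is Cauchy by the parallelogram law.\<close>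

lemma riesz_representation:
  fixes \<phi> :: "'a::complex_hilbert_space \<Rightarrow> complex"
  assumes add: "\<And>x y. \<phi> (x + y) = \<phi> x + \<phi> y"
    and scale: "\<And>c x. \<phi> (c *\<^sub>C x) = c * \<phi> x"
    and bound: "\<And>x. cmod (\<phi> x) \<le> K * norm x"
  obtains z where "\<And>x. \<phi> x = cinner x z"
proof -
  have scaleR: "\<phi> (r *\<^sub>R x) = of_real r * \<phi> x" for r x
    by (metis scale scaleC_of_real)
  have bl: "bounded_linear \<phi>"
    by (rule bounded_linear_intro[of _ K])
      (use bound in \<open>auto simp: add scaleR scaleR_conv_of_real mult.commute\<close>)
  define J where "J x = (norm x)\<^sup>2 - 2 * Re (\<phi> x)" for x
  have J_ge: "J x \<ge> - K\<^sup>2" for x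
  proof -
    have "Re (\<phi> x) \<le> K * norm x" using bound[of x] complex_Re_le_cmod order_trans by blast
    moreover have "0 \<le> (norm x - K)\<^sup>2" by simp
    ultimately show ?thesis unfolding J_def power2_diff by (simp add: mult_ac)
  qed
  define m where "m = Inf (range J)"
  have bdd: "bdd_below (range J)" using J_ge by (auto intro!: bdd_belowI)
  have m_le: "m \<le> J x" for x unfolding m_def by (intro cInf_lower bdd) auto
  have "\<exists>x. J x < m + 1 / real (Suc n)" for n
    using cInf_lessD[of "range J" "m + 1 / real (Suc n)"] by (auto simp: m_def)
  then obtain X where X: "\<And>n. J (X n) < m + 1 / real (Suc n)" by metis
  have par: "J x + J y - 2 * J ((1/2) *\<^sub>R (x + y)) = (norm (x - y))\<^sup>2 / 2" for x y
  proof -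
    have "(norm (x - y))\<^sup>2 = (norm x)\<^sup>2 - 2 * Re (cinner x y) + (norm y)\<^sup>2"
      using norm_add_square[of x "- y"] cinner_diff_right[of x 0 y] by simp
    moreover have "(norm ((1/2) *\<^sub>R (x + y)))\<^sup>2 = (norm (x + y))\<^sup>2 / 4"
      by (simp add: power_mult_distrib power_divide del: scaleR_add_right scaleR_right_distrib)
    moreover have "Re (\<phi> ((1/2) *\<^sub>R (x + y))) = (Re (\<phi> x) + Re (\<phi> y)) / 2"
      unfolding scaleR add by (simp flip: of_real_divide)
    ultimately show ?thesis
      using norm_add_square[of x y] unfolding J_def by argo
  qed
  \<comment> \<open>The midpoint has \<open>J\<close> at least \<open>m\<close>, so half the squared
    distance is at most the sum of two excesses over \<open>m\<close>, each at most 1 / (N +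
    1).\<close>
  have close: "(norm (X i - X j))\<^sup>2 \<le> 4 / real (Suc N)" if "i \<ge> N" "j \<ge> N" for i j N
  proof -
    have "1 / real (Suc i) \<le> 1 / real (Suc N)" "1 / real (Suc j) \<le> 1 / real (Suc N)"
      using that by (auto simp: frac_le)
    thus ?thesis
      using X[of i] X[of j] par[of "X i" "X j"] m_le[of "(1/2) *\<^sub>R (X i + X j)"] by simp
  qed
  have "Cauchy X"
  proof (rule metric_CauchyI)
    fix e :: real assume e: "e > 0"
    obtain N where N: "4 / e\<^sup>2 < real (Suc N)" 
      using reals_Archimedean2[of "4 / e\<^sup>2"] by (auto intro: that order_less_trans[OF _ of_nat_less_iff[THEN iffD2, OF lessI]])
    have "dist (X i) (X j) < e" if "i \<ge> N" "j \<ge> N" for i j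
    proof -
      have "4 / real (Suc N) < e\<^sup>2" using N e by (simp add: field_simps)
      with close[OF that] have "(norm (X i - X j))\<^sup>2 < e\<^sup>2" by linarith
      thus ?thesis using e by (simp add: dist_norm power_less_imp_less_base)
    qed
    thus "\<exists>M. \<forall>i\<ge>M. \<forall>j\<ge>M. dist (X i) (X j) < e" by blast
  qed
  then obtain z where z: "X \<longlonglongrightarrow> z" using Cauchy_convergent convergent_def by blast
  have "(\<lambda>n. J (X n)) \<longlonglongrightarrow> J z"
    unfolding J_def by (intro tendsto_intros bounded_linear.tendsto[OF bl] z)
  moreover have "(\<lambda>n. m + 1 / real (Suc n)) \<longlonglongrightarrow> m + 0"
    by (intro tendsto_intros LIMSEQ_Suc[OF lim_1_over_n])
  ultimately have "J z \<le> m + 0"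
    by (rule LIMSEQ_le) (use X in \<open>auto intro: less_imp_le\<close>)
  hence Jz: "J z \<le> J x" for x using m_le[of x] by simp
  have re: "Re (\<phi> h) = Re (cinner h z)" for h
  proof -
    \<comment> \<open>\<open>2 * a\<close> is the derivative of \<open>J\<close> at \<open>z\<close>
      in direction \<open>h\<close>. The optimal step would be \<open>- a / q\<close>; the summand 1
      in the denominator keeps the step defined for \<open>h = 0\<close> and still lowers
      \<open>J\<close> unless \<open>a = 0\<close>.\<close>
    define a where "a = Re (cinner z h) - Re (\<phi> h)"
    define q where "q = (norm h)\<^sup>2"
    define t where "t = - a / (q + 1)"
    have q: "q \<ge> 0" by (simp add: q_def)
    have "J (z + t *\<^sub>R h) - J z = 2 * t * a + t\<^sup>2 * q"
      by (simp add: J_def norm_add_square add scaleR cinner_scaleR_right a_def q_def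
          power_mult_distrib algebra_simps)
    hence "0 \<le> 2 * t * a + t\<^sup>2 * q" using Jz[of "z + t *\<^sub>R h"] by simp
    also have "\<dots> = - (a\<^sup>2 * (q + 2)) / (q + 1)\<^sup>2"
      using q by (simp add: t_def power_divide divide_simps) (simp add: power2_eq_square algebra_simps)
    finally have "a\<^sup>2 * (q + 2) \<le> 0" using q by (simp add: divide_simps power2_eq_square)
    hence "a = 0" using q by (simp add: mult_le_0_iff)
    moreover have "Re (cinner h z) = Re (cinner z h)" by (subst cinner_commute) simp
    ultimately show ?thesis by (simp add: a_def)
  qed
  have "\<phi> x = cinner x z" for x
  proof (rule complex_eqI)
    \<comment> \<open>Multiplication by -i turns imaginary parts into real parts, where
      \<open>re\<close> applies.\<close>
    show "Im (\<phi> x) = Im (cinner x z)"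
      using re[of "(-\<i>) *\<^sub>C x"] by (simp add: scale cinner_scaleC_left)
  qed (rule re)
  thus thesis by (rule that)
qed

text \<open>Riesz representation for each fixed \<open>x\<close>, applied to the conjugate because
  \<open>B\<close> is antilinear in its second slot. Adjoints and weak* integrals are both obtained
  from their coefficients in this way.\<close>

lemma operator_of_sesquilinear_form:
  fixes B :: "'a::complex_hilbert_space \<Rightarrow> 'a \<Rightarrow> complex"
  assumes addl: "\<And>x y z. B (x + y) z = B x z + B y z"
    and scalel: "\<And>c x z. B (c *\<^sub>C x) z = c * B x z"
    and addr: "\<And>x y z. B x (y + z) = B x y + B x z"
    and scaler: "\<And>c x z. B x (c *\<^sub>C z) = cnj c * B x z"
    and bound: "\<And>x y. cmod (B x y) \<le> C * norm x * norm y"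
    and C: "0 \<le> C"
  obtains A where "A \<in> bounded_ops" "\<And>x y. cinner (blinfun_apply A x) y = B x y" "norm A \<le> C"
proof -
  have "\<exists>z. \<forall>y. cinner z y = B x y" for x
  proof -
    obtain z where z: "\<And>y. cnj (B x y) = cinner y z"
      by (rule riesz_representation[of "\<lambda>y. cnj (B x y)" "C * norm x"])
        (auto simp: addr scaler bound)
    show ?thesis by (rule exI[of _ z]) (metis cinner_commute complex_cnj_cnj z)
  qed
  then obtain a where a: "\<And>x y. cinner (a x) y = B x y" by metis
  have scale: "a (c *\<^sub>C x) = c *\<^sub>C a x" for c x
    by (rule cinner_eqI) (simp add: a scalel cinner_scaleC_left)
  have norm_a: "norm (a x) \<le> C * norm x" for x
  proof (cases "a x = 0")
    case False
    have "norm (a x) * norm (a x) = cmod (cinner (a x) (a x))"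
      by (simp add: cinner_self_eq_norm power2_eq_square norm_mult)
    also have "\<dots> \<le> C * norm x * norm (a x)" unfolding a by (rule bound)
    finally show ?thesis using False by simp
  qed (use C in simp)
  have "bounded_linear a"
  proof (rule bounded_linear_intro[of _ C])
    show "a (x + y) = a x + a y" for x y
      by (rule cinner_eqI) (simp add: a addl cinner_add_left)
    show "a (r *\<^sub>R x) = r *\<^sub>R a x" for r x
      by (metis scale scaleC_of_real)
    show "norm (a x) \<le> norm x * C" for x using norm_a[of x] by (simp add: mult.commute)
  qed
  note app = bounded_linear_Blinfun_apply[OF this]
  show thesis
  proof (rule that[of "Blinfun a"])
    show "Blinfun a \<in> bounded_ops" by (simp add: bounded_ops_def app scale)
    show "cinner (blinfun_apply (Blinfun a) x) y = B x y" for x y by (simp add: app a)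
    show "norm (Blinfun a) \<le> C" by (rule norm_blinfun_bound) (auto simp: app norm_a C)
  qed
qed

section \<open>Bounded operators and adjoints\<close>

lemma blinfun_eq_cinnerI:
  fixes A B :: "'h::complex_hilbert_space \<Rightarrow>\<^sub>L 'h"
  assumes "\<And>x y. cinner (blinfun_apply A x) y = cinner (blinfun_apply B x) y"
  shows "A = B"
  by (rule blinfun_eqI, rule cinner_eqI) (rule assms)

lemma bounded_ops_scaleC: "T \<in> bounded_ops \<Longrightarrow> blinfun_apply T (c *\<^sub>C x) = c *\<^sub>C blinfun_apply T x"
  by (simp add: bounded_ops_def)

lemma bounded_ops_compose [intro]:
  "S \<in> bounded_ops \<Longrightarrow> T \<in> bounded_ops \<Longrightarrow> S o\<^sub>L T \<in> bounded_ops"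
  by (simp add: bounded_ops_def)

lemma id_in_bounded_ops [simp]: "id_blinfun \<in> bounded_ops"
  by (simp add: bounded_ops_def)

lemma bounded_linear_scaleC: "bounded_linear (\<lambda>x::'a::complex_hilbert_space. c *\<^sub>C x)"
proof (rule bounded_linear_intro[of _ "cmod c"])
  show "c *\<^sub>C r *\<^sub>R x = r *\<^sub>R c *\<^sub>C x" for r and x :: 'a
    by (simp add: scaleC_scaleC mult.commute flip: scaleC_of_real)
qed (auto simp: scaleC_add_right norm_scaleC)

lemma closed_bounded_ops: "closed (bounded_ops :: ('h::complex_hilbert_space \<Rightarrow>\<^sub>L 'h) set)"
proof -
  have "bounded_ops = (\<Inter>c. \<Inter>x. {T :: 'h \<Rightarrow>\<^sub>L 'h. blinfun_apply T (c *\<^sub>C x) = c *\<^sub>C blinfun_apply T x})"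
    by (auto simp: bounded_ops_def)
  moreover have "closed {T :: 'h \<Rightarrow>\<^sub>L 'h. blinfun_apply T (c *\<^sub>C x) = c *\<^sub>C blinfun_apply T x}" for c x
    by (intro closed_Collect_eq continuous_intros
        continuous_on_compose2[OF linear_continuous_on[OF bounded_linear_scaleC[of c]], where f="\<lambda>T. blinfun_apply T x"]) auto
  ultimately show ?thesis by (metis (no_types, lifting) closed_INT)
qed

lemma subspace_bounded_ops: "subspace (bounded_ops :: ('h::complex_hilbert_space \<Rightarrow>\<^sub>L 'h) set)"
proof (rule subspaceI)
  fix r and T :: "'h \<Rightarrow>\<^sub>L 'h" assume T: "T \<in> bounded_ops"
  show "r *\<^sub>R T \<in> bounded_ops"
    using T by (simp add: bounded_ops_def scaleC_scaleC mult.commute blinfun.scaleR_left flip: scaleC_of_real)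
next
  show "(0 :: 'h \<Rightarrow>\<^sub>L 'h) \<in> bounded_ops"
    using norm_scaleC[of _ "0::'h"] by (simp add: bounded_ops_def)
qed (simp add: bounded_ops_def blinfun.add_left scaleC_add_right)

text \<open>The form sending (x, y) to the inner product of x with T y is represented by an
  operator, which is unique since coefficients separate operators; this gives the description in
  \<open>adj\<close> its meaning.\<close>

lemma adj_characterization:
  assumes T: "(T :: 'h::complex_hilbert_space \<Rightarrow>\<^sub>L 'h) \<in> bounded_ops"
  shows adj_in_bounded_ops: "adj T \<in> bounded_ops"
    and cinner_adj: "cinner (blinfun_apply T x) y = cinner x (blinfun_apply (adj T) y)"
proof -
  obtain S where S: "S \<in> bounded_ops"
    "\<And>x y. cinner (blinfun_apply S x) y = cinner x (blinfun_apply T y)"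
  proof (rule operator_of_sesquilinear_form[of "\<lambda>x y. cinner x (blinfun_apply T y)" "norm T"])
    fix x y
    have "cmod (cinner x (blinfun_apply T y)) \<le> norm x * (norm T * norm y)"
      by (meson cinner_norm_le mult_left_mono norm_blinfun norm_ge_zero order_trans)
    thus "cmod (cinner x (blinfun_apply T y)) \<le> norm T * norm x * norm y" by (simp add: mult_ac)
  qed (auto simp: cinner_add_left cinner_add_right cinner_scaleC_left cinner_scaleC_right
      blinfun.add_right bounded_ops_scaleC[OF T])
  let ?P = "\<lambda>S. S \<in> bounded_ops \<and>
    (\<forall>x y. cinner (blinfun_apply T x) y = cinner x (blinfun_apply S y))"
  have "?P S" using S by (metis cinner_commute)
  moreover have "R = S" if "?P R" for R
  proof (rule blinfun_eq_cinnerI)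
    fix x y
    show "cinner (blinfun_apply R x) y = cinner (blinfun_apply S x) y"
      using that S(2) by (metis cinner_commute)
  qed
  ultimately have "?P (adj T)" unfolding adj_def by (rule theI)
  thus "adj T \<in> bounded_ops"
    "cinner (blinfun_apply T x) y = cinner x (blinfun_apply (adj T) y)" by auto
qed

lemma norm_adj_le:
  assumes "T \<in> bounded_ops"
  shows "norm (adj T) \<le> norm T"
proof (rule norm_blinfun_bound)
  fix x
  let ?y = "blinfun_apply (adj T) x"
  show "norm ?y \<le> norm T * norm x"
  proof (cases "?y = 0")
    case False
    have "norm ?y * norm ?y = cmod (cinner ?y ?y)"
      by (simp add: cinner_self_eq_norm power2_eq_square norm_mult)
    also have "\<dots> = cmod (cinner (blinfun_apply T ?y) x)"
      by (simp add: cinner_adj[OF assms])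
    also have "\<dots> \<le> norm (blinfun_apply T ?y) * norm x" by (rule cinner_norm_le)
    also have "\<dots> \<le> norm T * norm ?y * norm x" by (intro mult_right_mono norm_blinfun) auto
    finally show ?thesis using False by (simp add: mult_ac)
  qed simp
qed simp

lemma norm_compose_adj_le:
  assumes "T \<in> bounded_ops"
  shows "norm (T o\<^sub>L adj T) \<le> (norm T)\<^sup>2" "norm (adj T o\<^sub>L T) \<le> (norm T)\<^sup>2"
proof -
  have "norm T * norm (adj T) \<le> (norm T)\<^sup>2"
    by (simp add: power2_eq_square mult_left_mono norm_adj_le[OF assms])
  thus "norm (T o\<^sub>L adj T) \<le> (norm T)\<^sup>2" "norm (adj T o\<^sub>L T) \<le> (norm T)\<^sup>2"
    using norm_blinfun_compose[of T "adj T"] norm_blinfun_compose[of "adj T" T]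
    by (auto simp: mult.commute)
qed

section \<open>Normal functionals and weak* integrals\<close>

lemma summable_mult_of_squares:
  fixes a b :: "nat \<Rightarrow> real"
  assumes "summable (\<lambda>n. (a n)\<^sup>2)" "summable (\<lambda>n. (b n)\<^sup>2)" "\<And>n. 0 \<le> a n" "\<And>n. 0 \<le> b n"
  shows "summable (\<lambda>n. a n * b n)"
proof (rule summable_comparison_test'[OF summable_add[OF assms(1,2)]])
  fix n
  have "0 \<le> (a n - b n)\<^sup>2" by simp
  thus "norm (a n * b n) \<le> (a n)\<^sup>2 + (b n)\<^sup>2"
    using mult_nonneg_nonneg[OF assms(3)[of n] assms(4)[of n]] unfolding power2_diff real_norm_def by linarith
qed

text \<open>By ab \<le> a^2 + b^2 the norms of the defining vectors have summable products, and the
  coefficient series of every \<open>T\<close> is dominated by \<open>norm T\<close> times this one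
  series. That domination is what later permits termwise integration.\<close>

lemma predualE:
  assumes "\<omega> \<in> predual"
  obtains x y :: "nat \<Rightarrow> 'h::complex_hilbert_space"
  where "summable (\<lambda>n. norm (x n) * norm (y n))"
    "\<And>T. \<omega> T = (\<Sum>n. cinner (blinfun_apply T (x n)) (y n))"
    "\<And>T. summable (\<lambda>n. norm (cinner (blinfun_apply T (x n)) (y n)))"
    "\<And>T. norm (\<omega> T) \<le> norm T * (\<Sum>n. norm (x n) * norm (y n))"
    "\<And>T n. norm (cinner (blinfun_apply T (x n)) (y n)) \<le> norm T * (norm (x n) * norm (y n))"
proof -
  obtain x y :: "nat \<Rightarrow> 'h" where xy: "summable (\<lambda>n. (norm (x n))\<^sup>2)" "summable (\<lambda>n. (norm (y n))\<^sup>2)"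
    and w: "\<And>T. \<omega> T = (\<Sum>n. cinner (blinfun_apply T (x n)) (y n))"
    using assms by (auto simp: predual_def)
  have s: "summable (\<lambda>n. norm (x n) * norm (y n))"
    by (rule summable_mult_of_squares[OF xy]) auto
  have le: "norm (cinner (blinfun_apply T (x n)) (y n)) \<le> norm T * (norm (x n) * norm (y n))" for T n
  proof -
    have "norm (cinner (blinfun_apply T (x n)) (y n)) \<le> norm (blinfun_apply T (x n)) * norm (y n)"
      by (rule cinner_norm_le)
    also have "\<dots> \<le> norm T * norm (x n) * norm (y n)" by (intro mult_right_mono norm_blinfun) auto
    finally show ?thesis by (simp add: mult.assoc)
  qed
  have s': "summable (\<lambda>n. norm (cinner (blinfun_apply T (x n)) (y n)))" for T
    by (rule summable_comparison_test'[OF summable_mult[OF s, of "norm T"]]) (use le in auto)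
  show thesis
  proof (rule that[OF s w s' _ le])
    fix T
    have "norm (\<omega> T) \<le> (\<Sum>n. norm (cinner (blinfun_apply T (x n)) (y n)))"
      unfolding w by (rule summable_norm[OF s'])
    also have "\<dots> \<le> (\<Sum>n. norm T * (norm (x n) * norm (y n)))"
      by (rule suminf_le[OF le s' summable_mult[OF s]])
    also have "\<dots> = norm T * (\<Sum>n. norm (x n) * norm (y n))" by (rule suminf_mult[OF s])
    finally show "norm (\<omega> T) \<le> norm T * (\<Sum>n. norm (x n) * norm (y n))" .
  qed
qed

lemma bounded_linear_predual:
  assumes "\<omega> \<in> predual"
  shows "bounded_linear \<omega>"
proof -
  obtain x y where w: "\<And>T. \<omega> T = (\<Sum>n. cinner (blinfun_apply T (x n)) (y n))"
    and s: "\<And>T. summable (\<lambda>n. norm (cinner (blinfun_apply T (x n)) (y n)))"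
    and b: "\<And>T. norm (\<omega> T) \<le> norm T * (\<Sum>n. norm (x n) * norm (y n))"
    by (rule predualE[OF assms]) blast
  note s' = summable_norm_cancel[OF s]
  show ?thesis
  proof (rule bounded_linear_intro[OF _ _ b])
    show "\<omega> (S + T) = \<omega> S + \<omega> T" for S T
      unfolding w by (simp add: blinfun.add_left cinner_add_left suminf_add[OF s' s'])
    show "\<omega> (r *\<^sub>R T) = r *\<^sub>R \<omega> T" for r T
      unfolding w by (simp add: blinfun.scaleR_left cinner_scaleR_left scaleR_conv_of_real suminf_mult[OF s'])
  qed
qed

lemma rank_one_predual: "(\<lambda>T. cinner (blinfun_apply T x) y) \<in> predual"
proof -
  let ?x = "\<lambda>n::nat. if n = 0 then x else 0" and ?y = "\<lambda>n::nat. if n = 0 then y else 0"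
  have "summable (\<lambda>n. (norm (?x n))\<^sup>2)" "summable (\<lambda>n. (norm (?y n))\<^sup>2)"
    by (rule summable_finite[of "{0}"]; simp)+
  moreover have "(\<Sum>n. cinner (blinfun_apply T (?x n)) (?y n)) = cinner (blinfun_apply T x) y" for T
    by (subst suminf_finite[of "{0}"]) auto
  ultimately show ?thesis
    unfolding predual_def mem_Collect_eq by (intro exI[of _ ?x] exI[of _ ?y]) simp
qed

lemma predual_separates:
  assumes "\<And>\<omega>. \<omega> \<in> predual \<Longrightarrow> \<omega> A = \<omega> B"
  shows "A = B"
  by (rule blinfun_eq_cinnerI) (use assms[OF rank_one_predual] in simp)

lemma wstar_integral_eqI:
  assumes "A \<in> bounded_ops"
    and "\<And>\<omega>. \<omega> \<in> predual \<Longrightarrow>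
      integrable M (\<lambda>s. \<omega> (F s) * f s) \<and> \<omega> A = (LINT s|M. \<omega> (F s) * f s)"
  shows "wstar_integral M f F = A"
  unfolding wstar_integral_def
  by (rule the_equality) (use assms in \<open>auto intro!: predual_separates\<close>)

text \<open>Integrating coefficients gives a bounded sesquilinear form, hence an operator; a general
  normal functional is a countable sum of coefficients and is reached by termwise integration.
  Measurability is asked of coefficients because that is what strong continuity supplies.\<close>

lemma wstar_integral_bounded:
  fixes F :: "'g \<Rightarrow> ('h::complex_hilbert_space \<Rightarrow>\<^sub>L 'h)"
  assumes F: "\<And>s. F s \<in> bounded_ops" and C: "\<And>s. norm (F s) \<le> C"
    and meas: "\<And>x y. (\<lambda>s. cinner (blinfun_apply (F s) x) y) \<in> borel_measurable M"
    and f: "integrable M f"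
  shows wstar_integral_in_bounded_ops: "wstar_integral M f F \<in> bounded_ops"
    and wstar_integral_integrable: "\<omega> \<in> predual \<Longrightarrow> integrable M (\<lambda>s. \<omega> (F s) * f s)"
    and wstar_integral_predual:
      "\<omega> \<in> predual \<Longrightarrow> \<omega> (wstar_integral M f F) = (LINT s|M. \<omega> (F s) * f s)"
    and norm_wstar_integral_le: "norm (wstar_integral M f F) \<le> C * (LINT s|M. norm (f s))"
proof -
  have C0: "0 \<le> C" using C[of undefined] norm_ge_zero order_trans by blast
  note [measurable] = meas borel_measurable_integrable[OF f]
  have le: "norm (cinner (blinfun_apply (F s) x) y * f s) \<le> C * norm x * norm y * norm (f s)" for s x y
  proof -
    have "norm (cinner (blinfun_apply (F s) x) y) \<le> norm (blinfun_apply (F s) x) * norm y"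
      by (rule cinner_norm_le)
    also have "norm (blinfun_apply (F s) x) \<le> norm (F s) * norm x" by (rule norm_blinfun)
    also have "norm (F s) * norm x \<le> C * norm x" by (intro mult_right_mono C) auto
    finally show ?thesis by (simp add: norm_mult mult_right_mono)
  qed
  have int: "integrable M (\<lambda>s. cinner (blinfun_apply (F s) x) y * f s)" for x y
    by (rule Bochner_Integration.integrable_bound[of M "\<lambda>s. C * norm x * norm y * norm (f s)"])
      (use le C0 f in \<open>auto intro!: AE_I2 order_trans[OF le] simp: abs_mult\<close>)
  define B where "B x y = (LINT s|M. cinner (blinfun_apply (F s) x) y * f s)" for x y
  have B_le: "norm (B x y) \<le> C * (LINT s|M. norm (f s)) * norm x * norm y" for x y
  proof -
    have "norm (B x y) \<le> (LINT s|M. norm (cinner (blinfun_apply (F s) x) y * f s))"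
      unfolding B_def by (rule integral_norm_bound)
    also have "\<dots> \<le> (LINT s|M. C * norm x * norm y * norm (f s))"
      by (rule integral_mono) (use f int le in \<open>auto simp del: norm_mult\<close>)
    finally show ?thesis by (simp add: mult_ac)
  qed
  obtain A where A: "A \<in> bounded_ops" "\<And>x y. cinner (blinfun_apply A x) y = B x y"
    and norm_A: "norm A \<le> C * (LINT s|M. norm (f s))"
  proof (rule operator_of_sesquilinear_form[of B "C * (LINT s|M. norm (f s))"])
    show "B (x + y) z = B x z + B y z" for x y z
      unfolding B_def
      by (subst Bochner_Integration.integral_add[symmetric, OF int int])
        (simp add: blinfun.add_right cinner_add_left ring_distribs)
    show "B x (y + z) = B x y + B x z" for x y z
      unfolding B_def
      by (subst Bochner_Integration.integral_add[symmetric, OF int int])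
        (simp add: cinner_add_right ring_distribs)
    show "B (c *\<^sub>C x) z = c * B x z" for c x z
      unfolding B_def
      by (simp add: bounded_ops_scaleC[OF F] cinner_scaleC_left mult.assoc)
    show "B x (c *\<^sub>C z) = cnj c * B x z" for c x z
      unfolding B_def by (simp add: cinner_scaleC_right mult.assoc)
  qed (use B_le C0 in auto)
  have A': "integrable M (\<lambda>s. \<omega> (F s) * f s) \<and> \<omega> A = (LINT s|M. \<omega> (F s) * f s)"
    if \<omega>: "\<omega> \<in> predual" for \<omega>
  proof -
    obtain x y :: "nat \<Rightarrow> 'h" where sxy: "summable (\<lambda>n. norm (x n) * norm (y n))"
      and w: "\<And>T. \<omega> T = (\<Sum>n. cinner (blinfun_apply T (x n)) (y n))"
      and s: "\<And>T. summable (\<lambda>n. norm (cinner (blinfun_apply T (x n)) (y n)))"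
      by (rule predualE[OF \<omega>]) blast
    let ?h = "\<lambda>n s. cinner (blinfun_apply (F s) (x n)) (y n) * f s"
    have s1: "AE s in M. summable (\<lambda>n. norm (?h n s))"
      by (rule AE_I2) (simp only: norm_mult summable_mult2[OF s])
    have s2: "summable (\<lambda>n. LINT s|M. norm (?h n s))"
    proof (rule summable_comparison_test'[OF summable_mult2[OF sxy]])
      fix n
      have "(LINT s|M. norm (?h n s)) \<le> (LINT s|M. C * norm (x n) * norm (y n) * norm (f s))"
        by (rule integral_mono) (use f int le in \<open>auto simp del: norm_mult\<close>)
      thus "norm (LINT s|M. norm (?h n s)) \<le>
          norm (x n) * norm (y n) * (C * (LINT s|M. norm (f s)))"
        by (simp add: mult_ac)
    qed
    have h: "(\<Sum>n. ?h n s) = \<omega> (F s) * f s" for s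
      unfolding w by (rule suminf_mult2[OF summable_norm_cancel[OF s], symmetric])
    have "\<omega> A = (\<Sum>n. LINT s|M. ?h n s)" unfolding w A(2) B_def ..
    also have "\<dots> = (LINT s|M. \<omega> (F s) * f s)"
      using integral_suminf[OF int s1 s2] unfolding h by simp
    finally show ?thesis
      using integrable_suminf[OF int s1 s2] unfolding h by simp
  qed
  have eq: "wstar_integral M f F = A" using A(1) A' by (rule wstar_integral_eqI)
  show "wstar_integral M f F \<in> bounded_ops"
    "\<omega> \<in> predual \<Longrightarrow> integrable M (\<lambda>s. \<omega> (F s) * f s)"
    "\<omega> \<in> predual \<Longrightarrow> \<omega> (wstar_integral M f F) = (LINT s|M. \<omega> (F s) * f s)"
    "norm (wstar_integral M f F) \<le> C * (LINT s|M. norm (f s))"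
    using A A' norm_A by (auto simp: eq)
qed

section \<open>Absolutely convergent series in the Haagerup tensor product\<close>

text \<open>Square summability makes the sums of v v^* and of w^* w absolutely convergent in norm,
  hence also weak* convergent. The hypothesis on \<open>T\<close> concerns ordered sums; absolute
  convergence makes them unordered.\<close>

lemma haagerup_tensor_of_square_summable:
  fixes v w :: "nat \<Rightarrow> ('h::complex_hilbert_space \<Rightarrow>\<^sub>L 'h)"
  assumes V: "V \<subseteq> bounded_ops" "W \<subseteq> bounded_ops"
    and vw: "\<And>p. v p \<in> V" "\<And>p. w p \<in> W"
    and sv: "summable (\<lambda>p. (norm (v p))\<^sup>2)" and sw: "summable (\<lambda>p. (norm (w p))\<^sup>2)"
    and T: "T \<in> bounded_ops \<rightarrow>\<^sub>E bounded_ops"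
    and sums: "\<And>x \<omega>. x \<in> bounded_ops \<Longrightarrow> \<omega> \<in> predual \<Longrightarrow>
      (\<lambda>p. \<omega> (v p o\<^sub>L x o\<^sub>L w p)) sums \<omega> (T x)"
  shows "T \<in> V \<otimes>h W"
proof -
  \<comment> \<open>A copy of the natural numbers inside \<open>'h \<times> nat\<close>, the type
    from which the tensor product draws its index sets.\<close>
  define I :: "('h \<times> nat) set" where "I = Pair undefined ` UNIV"
  have inj: "inj_on (Pair (undefined::'h)) UNIV" by (simp add: inj_on_def)
  have transfer: "((\<lambda>i. g (snd i)) has_sum S) I \<longleftrightarrow> (g has_sum S) UNIV"
    for g :: "nat \<Rightarrow> 'z::{comm_monoid_add,topological_space}" and S
    unfolding I_def by (subst has_sum_reindex[OF inj]) (simp add: o_def)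
  have bo: "v p \<in> bounded_ops" "w p \<in> bounded_ops" for p using V vw by auto
  have wstar: "\<exists>A. wstar_has_sum (\<lambda>i. g (snd i)) A I \<and> ((\<lambda>i. g (snd i)) has_sum A) I"
    if g: "\<And>p. g p \<in> bounded_ops" and n: "\<And>p. norm (g p) \<le> r p" and r: "summable r"
    for g :: "nat \<Rightarrow> ('h \<Rightarrow>\<^sub>L 'h)" and r
  proof -
    have s: "summable (\<lambda>p. norm (g p))" by (rule summable_comparison_test'[OF r]) (simp add: n)
    have sg: "g sums suminf g" using summable_norm_cancel[OF s] by (rule summable_sums)
    have h: "(g has_sum suminf g) UNIV" by (rule norm_summable_imp_has_sum[OF s sg])
    have "suminf g \<in> bounded_ops"
      by (rule closed_sequentially[OF closed_bounded_ops _ sg[unfolded sums_def]])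
        (auto intro!: subspace_sum[OF subspace_bounded_ops] g)
    moreover have "((\<lambda>i. \<omega> (g (snd i))) has_sum \<omega> (suminf g)) I" if "\<omega> \<in> predual" for \<omega>
      using has_sum_bounded_linear[OF bounded_linear_predual[OF that] h]
      by (simp add: transfer[of "\<lambda>p. \<omega> (g p)"])
    ultimately show ?thesis using h by (auto simp: wstar_has_sum_def transfer)
  qed
  obtain A where A: "wstar_has_sum (\<lambda>i. v (snd i) o\<^sub>L adj (v (snd i))) A I"
      "((\<lambda>i. v (snd i) o\<^sub>L adj (v (snd i))) has_sum A) I"
    using wstar[of "\<lambda>p. v p o\<^sub>L adj (v p)", OF bounded_ops_compose norm_compose_adj_le(1)[OF bo(1)] sv]
      bo(1) adj_in_bounded_ops[OF bo(1)] by blast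
  obtain B where B: "wstar_has_sum (\<lambda>i. adj (w (snd i)) o\<^sub>L w (snd i)) B I"
      "((\<lambda>i. adj (w (snd i)) o\<^sub>L w (snd i)) has_sum B) I"
    using wstar[of "\<lambda>p. adj (w p) o\<^sub>L w p", OF bounded_ops_compose norm_compose_adj_le(2)[OF bo(2)] sw]
      bo(2) adj_in_bounded_ops[OF bo(2)] by blast
  have "wstar_has_sum (\<lambda>i. v (snd i) o\<^sub>L x o\<^sub>L w (snd i)) (T x) I" if x: "x \<in> bounded_ops" for x
  proof -
    have "((\<lambda>i. \<omega> (v (snd i) o\<^sub>L x o\<^sub>L w (snd i))) has_sum \<omega> (T x)) I" if \<omega>: "\<omega> \<in> predual" for \<omega>
    proof -
      have le: "norm (v p o\<^sub>L x o\<^sub>L w p) \<le> norm x * (norm (v p) * norm (w p))" for p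
      proof -
        have "norm (v p o\<^sub>L x o\<^sub>L w p) \<le> norm (v p o\<^sub>L x) * norm (w p)" by (rule norm_blinfun_compose)
        also have "\<dots> \<le> (norm (v p) * norm x) * norm (w p)"
          by (intro mult_right_mono norm_blinfun_compose) auto
        finally show ?thesis by (simp add: mult_ac)
      qed
      have "summable (\<lambda>p. norm (v p) * norm (w p))"
        by (rule summable_mult_of_squares[OF sv sw]) auto
      from summable_mult[OF this, of "norm x"]
      have s: "summable (\<lambda>p. norm (v p o\<^sub>L x o\<^sub>L w p))"
        by (rule summable_comparison_test'[where N=0]) (simp only: real_norm_def abs_norm_cancel le)
      obtain K where K: "\<And>S. norm (\<omega> S) \<le> norm S * K"
        using bounded_linear.bounded[OF bounded_linear_predual[OF \<omega>]] by blast
      from summable_mult2[OF s, of K] have "summable (\<lambda>p. norm (\<omega> (v p o\<^sub>L x o\<^sub>L w p)))"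
        by (rule summable_comparison_test'[where N=0]) (simp only: real_norm_def abs_norm_cancel K)
      from norm_summable_imp_has_sum[OF this sums[OF x \<omega>]] show ?thesis
        by (simp add: transfer[of "\<lambda>p. \<omega> (v p o\<^sub>L x o\<^sub>L w p)"])
    qed
    thus ?thesis using T x by (auto simp: wstar_has_sum_def)
  qed
  hence "eh_series V W I (\<lambda>i. v (snd i)) (\<lambda>i. w (snd i)) T"
    unfolding eh_series_def using vw A B T by blast
  thus ?thesis
    unfolding haagerup_tensor_def ext_haagerup_tensor_def using A(2) B(2)
    by (auto simp: summable_on_def)
qed

text \<open>Moving a real scalar from one factor to the other does not change x \<mapsto> v x w,
  which reduces an absolutely convergent series to the square summable case; the subspace hypotheses
  keep the rescaled factors in \<open>V\<close> and \<open>W\<close>.\<close>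

lemma haagerup_tensorI:
  fixes v w :: "nat \<Rightarrow> ('h::complex_hilbert_space \<Rightarrow>\<^sub>L 'h)"
  assumes V: "V \<subseteq> bounded_ops" "W \<subseteq> bounded_ops" and sub: "subspace V" "subspace W"
    and vw: "\<And>p. v p \<in> V" "\<And>p. w p \<in> W"
    and s: "summable (\<lambda>p. norm (v p) * norm (w p))"
    and T: "T \<in> bounded_ops \<rightarrow>\<^sub>E bounded_ops"
    and sums: "\<And>x \<omega>. x \<in> bounded_ops \<Longrightarrow> \<omega> \<in> predual \<Longrightarrow>
      (\<lambda>p. \<omega> (v p o\<^sub>L x o\<^sub>L w p)) sums \<omega> (T x)"
  shows "T \<in> V \<otimes>h W"
proof -
  \<comment> \<open>Rescaling the two factors to equal norm; the terms with a vanishing factor are killed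
    by \<open>x / 0 = 0\<close>.\<close>
  define r where "r p = sqrt (norm (w p) / norm (v p))" for p
  define v' where "v' p = r p *\<^sub>R v p" for p
  define w' where "w' p = inverse (r p) *\<^sub>R w p" for p
  have "(norm (v' p))\<^sup>2 = norm (v p) * norm (w p)" "(norm (w' p))\<^sup>2 = norm (v p) * norm (w p)" for p
    by (auto simp: v'_def w'_def r_def power_mult_distrib power_divide field_simps power2_eq_square)
  moreover have "v' p o\<^sub>L x o\<^sub>L w' p = v p o\<^sub>L x o\<^sub>L w p" for p x
  proof (cases "v p = 0 \<or> w p = 0")
    case False
    hence "r p \<noteq> 0" by (simp add: r_def)
    thus ?thesis
      by (simp add: v'_def w'_def bounded_bilinear.scaleR_left[OF bounded_bilinear_blinfun_compose]
          bounded_bilinear.scaleR_right[OF bounded_bilinear_blinfun_compose])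
  qed (auto simp: v'_def w'_def)
  ultimately show ?thesis
    using s sums
    by (intro haagerup_tensor_of_square_summable[OF V _ _ _ _ T, of v' w'])
      (auto simp: v'_def w'_def intro!: subspace_scale sub vw)
qed

lemma summable_on_product_real:
  fixes a :: "'i \<Rightarrow> real" and b :: "'j \<Rightarrow> real"
  assumes "a summable_on UNIV" "b summable_on UNIV" "\<And>i. 0 \<le> a i" "\<And>j. 0 \<le> b j"
  shows "(\<lambda>(i,j). a i * b j) summable_on UNIV"
proof -
  have "(\<lambda>(i,j). a i * b j) summable_on (SIGMA i:UNIV. UNIV)"
  proof (rule summable_on_SigmaI[where g="\<lambda>i. a i * infsum b UNIV"])
    show "((\<lambda>j. case (i, j) of (i, j) \<Rightarrow> a i * b j) has_sum a i * infsum b UNIV) UNIV" for i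
      using assms(2) by (auto intro: has_sum_cmult_right)
    show "(\<lambda>i. a i * infsum b UNIV) summable_on UNIV"
      using assms(1) by (rule summable_on_cmult_left)
  qed (use assms in auto)
  thus ?thesis by simp
qed

text \<open>The double family is dominated by a constant times the products of the norms, so it may
  be summed over \<open>j\<close> first and then over \<open>i\<close>; each stage applies one
  bounded linear map to one convergent series.\<close>

lemma has_sum_sandwich:
  fixes a :: "'i \<Rightarrow> ('h::real_normed_vector \<Rightarrow>\<^sub>L 'h)" and b :: "'j \<Rightarrow> ('h \<Rightarrow>\<^sub>L 'h)"
    and \<omega> :: "('h \<Rightarrow>\<^sub>L 'h) \<Rightarrow> 'c::banach"
  assumes a: "(a has_sum A) UNIV" "(\<lambda>i. norm (a i)) summable_on UNIV"
    and b: "(b has_sum B) UNIV" "(\<lambda>j. norm (b j)) summable_on UNIV"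
    and \<omega>: "bounded_linear \<omega>"
  shows "((\<lambda>(i,j). \<omega> (a i o\<^sub>L x o\<^sub>L b j)) has_sum \<omega> (A o\<^sub>L x o\<^sub>L B)) UNIV"
    and "(\<lambda>p. norm (case p of (i,j) \<Rightarrow> \<omega> (a i o\<^sub>L x o\<^sub>L b j))) summable_on UNIV"
proof -
  obtain K where K: "K \<ge> 0" "\<And>S. norm (\<omega> S) \<le> norm S * K"
    using bounded_linear.nonneg_bounded[OF \<omega>] by blast
  have bound: "norm (\<omega> (a i o\<^sub>L x o\<^sub>L b j)) \<le> K * norm x * (norm (a i) * norm (b j))" for i j
  proof -
    have "norm (a i o\<^sub>L x o\<^sub>L b j) \<le> norm (a i o\<^sub>L x) * norm (b j)" by (rule norm_blinfun_compose)
    also have "\<dots> \<le> (norm (a i) * norm x) * norm (b j)"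
      by (intro mult_right_mono norm_blinfun_compose) auto
    finally have "norm (a i o\<^sub>L x o\<^sub>L b j) * K \<le> norm (a i) * norm x * norm (b j) * K"
      using K(1) by (rule mult_right_mono)
    with K(2)[of "a i o\<^sub>L x o\<^sub>L b j"] show ?thesis by (simp add: mult_ac)
  qed
  have "(\<lambda>(i,j). norm (a i) * norm (b j)) summable_on UNIV"
    by (rule summable_on_product_real[OF a(2) b(2)]) auto
  note summable_on_cmult_right[OF this, of "K * norm x"]
  then show abs: "(\<lambda>p. norm (case p of (i,j) \<Rightarrow> \<omega> (a i o\<^sub>L x o\<^sub>L b j))) summable_on UNIV"
    by (rule summable_on_comparison_test) (use bound in auto)
  have "((\<lambda>(i,j). \<omega> (a i o\<^sub>L x o\<^sub>L b j)) has_sum \<omega> (A o\<^sub>L x o\<^sub>L B)) (SIGMA i:UNIV. UNIV)"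
  proof (rule has_sum_SigmaI[where g="\<lambda>i. \<omega> (a i o\<^sub>L x o\<^sub>L B)"])
    fix i
    have "bounded_linear (\<lambda>S. \<omega> (a i o\<^sub>L x o\<^sub>L S))"
      by (rule bounded_linear_compose[OF \<omega> bounded_bilinear.bounded_linear_right[OF bounded_bilinear_blinfun_compose]])
    from has_sum_bounded_linear[OF this b(1)]
    show "((\<lambda>j. case (i, j) of (i, j) \<Rightarrow> \<omega> (a i o\<^sub>L x o\<^sub>L b j)) has_sum \<omega> (a i o\<^sub>L x o\<^sub>L B)) UNIV"
      by simp
  next
    have "bounded_linear (\<lambda>S. \<omega> ((S o\<^sub>L x) o\<^sub>L B))"
      by (rule bounded_linear_compose[OF \<omega> bounded_linear_compose
            [OF bounded_bilinear.bounded_linear_left[OF bounded_bilinear_blinfun_compose]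
              bounded_bilinear.bounded_linear_left[OF bounded_bilinear_blinfun_compose]]])
    from has_sum_bounded_linear[OF this a(1)]
    show "((\<lambda>i. \<omega> (a i o\<^sub>L x o\<^sub>L B)) has_sum \<omega> (A o\<^sub>L x o\<^sub>L B)) UNIV" .
  next
    show "(\<lambda>(i,j). \<omega> (a i o\<^sub>L x o\<^sub>L b j)) summable_on (SIGMA i:UNIV. UNIV)"
      using abs_summable_summable[OF abs] by simp
  qed
  thus "((\<lambda>(i,j). \<omega> (a i o\<^sub>L x o\<^sub>L b j)) has_sum \<omega> (A o\<^sub>L x o\<^sub>L B)) UNIV" by simp
qed

section \<open>Countably valued expansions of continuous functions\<close>

text \<open>The union of finite nets of mesh 1 / (n + 1). The ambient space, later the operators on
  H, need not be separable, so separability has to come from compactness.\<close>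

lemma compact_countable_dense:
  fixes K :: "'a::metric_space set"
  assumes "compact K"
  obtains D where "countable D" "D \<subseteq> K" "K \<subseteq> closure D"
proof -
  have "\<forall>\<epsilon>>0. \<exists>k. finite k \<and> k \<subseteq> K \<and> K \<subseteq> (\<Union>x\<in>k. ball x \<epsilon>)"
    by (rule seq_compact_imp_totally_bounded) (use assms compact_imp_seq_compact in blast)
  hence "\<exists>k. finite k \<and> k \<subseteq> K \<and> K \<subseteq> (\<Union>x\<in>k. ball x (1 / real (Suc n)))" for n by simp
  then obtain k where k: "\<And>n. finite (k n)" "\<And>n. k n \<subseteq> K"
    "\<And>n. K \<subseteq> (\<Union>x\<in>k n. ball x (1 / real (Suc n)))" by metis
  show thesis
  proof (rule that[of "\<Union>n. k n"])
    show "countable (\<Union>n. k n)" using k(1) by (intro countable_UN) (auto intro: countable_finite)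
    show "K \<subseteq> closure (\<Union>n. k n)"
    proof
      fix x assume x: "x \<in> K"
      show "x \<in> closure (\<Union>n. k n)"
        unfolding closure_approachable
      proof (intro allI impI)
        fix e :: real assume "e > 0"
        then obtain n where n: "1 / real (Suc n) < e" by (rule nat_approx_posE)
        from k(3)[of n] x obtain y where "y \<in> k n" "dist y x < 1 / real (Suc n)" by auto
        thus "\<exists>y\<in>\<Union>n. k n. dist y x < e" using n by (meson UN_I UNIV_I order_less_trans)
      qed
    qed
  qed (use k(2) in auto)
qed

text \<open>Level \<open>k\<close> of the expansion is the difference of two successive approximants of \<open>F\<close> with values
  in \<open>range e\<close>, of accuracy $2^{1-k}$ and $2^{-k}$; the approximant at level 0 is \<open>e 0 = 0\<close>.\<close>

lemma countably_valued_expansion: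
  fixes F :: "'a::topological_space \<Rightarrow> 'b::banach" and e :: "nat \<Rightarrow> 'b"
  assumes cont: "continuous_on UNIV F" and e0: "e 0 = 0" and bound: "\<And>s. norm (F s) \<le> 1"
  obtains E d where "\<And>j::nat. E j \<in> sets borel" "\<And>j. \<exists>m n. d j = e m - e n"
    "\<And>s. F s \<in> closure (range e) \<Longrightarrow>
      ((\<lambda>j. indicat_real (E j) s *\<^sub>R d j) has_sum F s) UNIV"
    "\<And>s. F s \<in> closure (range e) \<Longrightarrow>
      (\<lambda>j. norm (indicat_real (E j) s *\<^sub>R d j)) summable_on UNIV"
    "\<And>s. F s \<in> closure (range e) \<Longrightarrow>
      (\<Sum>\<^sub>\<infinity>j. norm (indicat_real (E j) s *\<^sub>R d j)) \<le> 6"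
proof -
  \<comment> \<open>Choosing the least admissible index makes the approximant a countably valued
    function of \<open>s\<close> with Borel level sets.\<close>
  define n where "n k s = (LEAST i. dist (e i) (F s) < 2 * (1/2)^k)" for k s
  have n_meas: "{s. n k s = a} \<in> sets borel" for k a
  proof -
    have [measurable]: "(\<lambda>s. dist (e i) (F s)) \<in> borel_measurable borel" for i
      by (intro borel_measurable_continuous_onI continuous_intros cont)
    have "{s \<in> space borel. n k s = a} \<in> sets borel" unfolding n_def by measurable
    thus ?thesis by simp
  qed
  \<comment> \<open>The index \<open>j\<close> codes a level k and a pair (a, b): on
    \<open>E j\<close> the approximant passes from \<open>e a\<close> at level k to
    \<open>e b\<close> at level k + 1.\<close>
  define E where "E j = (let (k, r) = prod_decode j; (a, b) = prod_decode r in
    {s. n k s = a} \<inter> {s. n (Suc k) s = b})" for j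
  define d where "d j = (let (k, r) = prod_decode j; (a, b) = prod_decode r in e b - e a)" for j
  show thesis
  proof (rule that[of E d])
    show "E j \<in> sets borel" for j
      unfolding E_def Let_def by (auto split: prod.split intro!: n_meas sets.Int)
    show "\<exists>m n. d j = e m - e n" for j
      unfolding d_def Let_def by (auto split: prod.split)
    fix s assume s: "F s \<in> closure (range e)"
    define p where "p k = e (n k s)" for k
    have p: "norm (p k - F s) < 2 * (1/2)^k" for k
    proof -
      have "\<exists>i. dist (e i) (F s) < 2 * (1/2)^k"
        using s unfolding closure_approachable by (metis rangeE zero_less_mult_iff zero_less_numeral
            zero_less_power zero_less_divide_1_iff)
      from LeastI_ex[OF this] show ?thesis by (simp add: p_def n_def dist_norm)
    qed
    \<comment> \<open>The tolerance at level 0 is 2, strictly above the bound 1 on \<open>F\<close>,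
      so \<open>e 0 = 0\<close> is admissible and comes first.\<close>
    have "n 0 s = 0" unfolding n_def using bound[of s] by (intro Least_eq_0) (simp add: e0)
    hence p0: "p 0 = 0" by (simp add: p_def e0)
    define D where "D k = p (Suc k) - p k" for k
    \<comment> \<open>The errors 2 / 2^k and 2 / 2^(k+1) of the two approximants add up to 3 / 2^k;
      the geometric series then yields the constant 6.\<close>
    have D: "norm (D k) \<le> 3 * (1/2)^k" for k
    proof -
      have "norm (D k) \<le> norm (p (Suc k) - F s) + norm (p k - F s)"
        unfolding D_def by (metis dist_norm dist_triangle2 norm_minus_commute dist_commute)
      also have "\<dots> \<le> 3 * (1/2)^k" using p[of k] p[of "Suc k"] by simp
      finally show ?thesis .
    qed
    have geo: "(\<lambda>k. 3 * (1/2::real)^k) sums 6"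
      using sums_mult[OF geometric_sums[of "1/2::real"], of 3] by simp
    have sD: "summable (\<lambda>k. norm (D k))"
      by (rule summable_comparison_test'[OF sums_summable[OF geo]]) (simp add: D)
    have "p \<longlonglongrightarrow> F s"
    proof (rule Lim_null_comparison[THEN LIM_zero_cancel])
      show "\<forall>\<^sub>F k in sequentially. norm (p k - F s) \<le> 2 * (1/2)^k"
        using p by (intro always_eventually allI less_imp_le)
      show "(\<lambda>k. 2 * (1/2::real)^k) \<longlonglongrightarrow> 0"
        by (intro tendsto_mult_right_zero LIMSEQ_power_zero) simp
    qed
    from telescope_sums[OF this] have "D sums F s" by (simp add: D_def[abs_def] p0)
    from norm_summable_imp_has_sum[OF sD this] have hD: "(D has_sum F s) UNIV" .
    \<comment> \<open>For a fixed \<open>s\<close> exactly one index per level has \<open>s\<close>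
      in its set, namely \<open>h k\<close>; all other terms vanish.\<close>
    define h where "h k = prod_encode (k, prod_encode (n k s, n (Suc k) s))" for k
    have inj: "inj h" by (auto simp: h_def inj_def)
    have dh: "d (h k) = D k" for k by (simp add: d_def h_def D_def p_def)
    have Eh: "s \<in> E (h k)" for k by (simp add: E_def h_def)
    have range_h: "j \<in> range h" if "s \<in> E j" for j
    proof -
      obtain k r a b where j: "prod_decode j = (k, r)" "prod_decode r = (a, b)" by fastforce
      have "j = h k" using that j by (simp add: E_def h_def) (metis prod_decode_inverse)
      thus ?thesis by simp
    qed
    \<comment> \<open>A general \<open>g\<close> with \<open>g 0 = 0\<close> covers both the series
      itself and the series of its norms.\<close>
    have transfer: "((\<lambda>j. g (indicat_real (E j) s *\<^sub>R d j)) has_sum S) UNIV \<longleftrightarrow>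
        ((\<lambda>k. g (D k)) has_sum S) UNIV"
      if g: "g 0 = 0" for g :: "'b \<Rightarrow> 'z::{comm_monoid_add,topological_space}" and S
    proof -
      have "((\<lambda>j. g (indicat_real (E j) s *\<^sub>R d j)) has_sum S) UNIV \<longleftrightarrow>
          ((\<lambda>j. g (d j)) has_sum S) (range h)"
        by (rule has_sum_cong_neutral) (use range_h Eh g in \<open>auto simp: indicator_def\<close>)
      also have "\<dots> \<longleftrightarrow> ((\<lambda>k. g (D k)) has_sum S) UNIV"
        by (subst has_sum_reindex[OF inj]) (simp add: o_def dh)
      finally show ?thesis .
    qed
    show "((\<lambda>j. indicat_real (E j) s *\<^sub>R d j) has_sum F s) UNIV"
      using transfer[of "\<lambda>x. x"] hD by simp
    have nD: "((\<lambda>k. norm (D k)) has_sum (\<Sum>k. norm (D k))) UNIV"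
      by (rule norm_summable_imp_has_sum) (use sD in auto)
    hence hn: "((\<lambda>j. norm (indicat_real (E j) s *\<^sub>R d j)) has_sum (\<Sum>k. norm (D k))) UNIV"
      using transfer[of norm] by simp
    thus "(\<lambda>j. norm (indicat_real (E j) s *\<^sub>R d j)) summable_on UNIV"
      by (auto simp: summable_on_def)
    have "(\<Sum>k. norm (D k)) \<le> (\<Sum>k. 3 * (1/2)^k)"
      by (rule suminf_le[OF D sD sums_summable[OF geo]])
    also have "\<dots> = 6" using geo by (rule sums_unique[symmetric])
    finally show "(\<Sum>\<^sub>\<infinity>j. norm (indicat_real (E j) s *\<^sub>R d j)) \<le> 6"
      using infsumI[OF hn] by simp
  qed
qed

section \<open>Left Haar measure\<close>

context
  fixes M :: "'g::{topological_group_add,t2_space} measure"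
  assumes haar: "left_haar_measure M"
begin

lemma sets_haar: "sets M = sets borel"
  using haar by (simp add: left_haar_measure_def)

lemma space_haar: "space M = UNIV"
  using sets_eq_imp_space_eq[OF sets_haar] by simp

lemma emeasure_haar_image: "A \<in> sets borel \<Longrightarrow> emeasure M ((\<lambda>t. s + t) ` A) = emeasure M A"
  using haar by (simp add: left_haar_measure_def)

lemma emeasure_haar_compact: "compact K \<Longrightarrow> emeasure M K < \<infinity>"
  using haar by (simp add: left_haar_measure_def)

section \<open>Translation invariance of the Haar integral and positivity on open sets\<close>

lemma continuous_add_left: "continuous_on UNIV (\<lambda>t::'g. s + t)"
  by (intro continuous_on_tendsto_compose continuous_at_imp_continuous_on ballI)
    (auto simp: continuous_at intro!: tendsto_intros)

lemma image_add_left: "(\<lambda>t. s + t) ` A = (\<lambda>t. - s + t) -` (A :: 'g set)"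
proof -
  have "s + (- s + t) = t" for t by (simp add: add.assoc[symmetric])
  thus ?thesis by (force simp: add.assoc[symmetric])
qed

lemma measurable_add_left: "(\<lambda>t. s + t) \<in> measurable M M"
  using borel_measurable_continuous_onI[OF continuous_add_left]
  by (simp add: measurable_cong_sets[OF sets_haar sets_haar])

lemma distr_add_left: "distr M M (\<lambda>t. s + t) = M"
proof (rule measure_eqI)
  fix A assume "A \<in> sets (distr M M ((+) s))"
  hence A: "A \<in> sets M" by simp
  have "emeasure (distr M M ((+) s)) A = emeasure M ((\<lambda>t. s + t) -` A)"
    using A by (simp add: emeasure_distr[OF measurable_add_left] space_haar)
  also have "(\<lambda>t. s + t) -` A = (\<lambda>t. - s + t) ` A" using image_add_left[of "-s" A] by simp
  also have "emeasure M \<dots> = emeasure M A" using A by (simp add: emeasure_haar_image sets_haar)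
  finally show "emeasure (distr M M ((+) s)) A = emeasure M A" .
qed simp

lemma haar_integral_translate:
  fixes f :: "'g \<Rightarrow> 'b::{banach,second_countable_topology}"
  assumes "f \<in> borel_measurable M"
  shows "(LINT t|M. f (s + t)) = (LINT t|M. f t)"
  using integral_distr[OF measurable_add_left[of s] assms] by (simp add: distr_add_left)

lemma haar_integrable_translate:
  fixes f :: "'g \<Rightarrow> 'b::{banach,second_countable_topology}"
  assumes "integrable M f"
  shows "integrable M (\<lambda>t. f (s + t))"
  by (rule integrable_distr[OF measurable_add_left[of s]]) (simp add: distr_add_left assms)

lemma open_translate: "open U \<Longrightarrow> open ((\<lambda>t. s + t) ` (U :: 'g set))"
  unfolding image_add_left by (rule open_vimage[OF _ continuous_add_left])

text \<open>Finitely many left translates of \<open>U\<close> cover a given compact set. If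
  \<open>U\<close> were null, all compact sets would be null, and inner regularity on the open set
  \<open>UNIV\<close> would make the measure vanish.\<close>

lemma haar_open_pos:
  assumes "open U" "U \<noteq> {}"
  shows "emeasure M U \<noteq> 0"
proof
  assume U0: "emeasure M U = 0"
  obtain u where u: "u \<in> U" using assms by blast
  have "emeasure M K = 0" if K: "compact K" for K
  proof -
    let ?V = "\<lambda>k. (\<lambda>t. (k - u) + t) ` U"
    have "K \<subseteq> (\<Union>k\<in>K. ?V k)"
    proof
      fix k assume "k \<in> K"
      moreover have "k = (k - u) + u" by simp
      ultimately show "k \<in> (\<Union>k\<in>K. ?V k)" using u by blast
    qed
    then obtain C where C: "C \<subseteq> K" "finite C" "K \<subseteq> (\<Union>k\<in>C. ?V k)"
      by (rule compactE_image[OF K, rotated]) (use open_translate assms in auto)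
    have sets: "?V k \<in> sets M" for k using open_translate[OF assms(1)] by (simp add: sets_haar)
    have "emeasure M K \<le> emeasure M (\<Union>k\<in>C. ?V k)"
      using C(2,3) sets by (intro emeasure_mono sets.finite_UN) auto
    also have "\<dots> \<le> (\<Sum>k\<in>C. emeasure M (?V k))"
      using C(2) sets by (intro emeasure_subadditive_finite) auto
    also have "\<dots> = 0"
      using assms(1) by (intro sum.neutral ballI, subst emeasure_haar_image) (auto simp: U0)
    finally show ?thesis by simp
  qed
  hence "(SUP K\<in>{K. compact K \<and> K \<subseteq> UNIV}. emeasure M K) = 0"
    by (simp add: SUP_eq_iff) (metis (mono_tags, lifting) SUP_bot bot_ennreal SUP_cong mem_Collect_eq)
  moreover have "emeasure M UNIV = (SUP K\<in>{K. compact K \<and> K \<subseteq> UNIV}. emeasure M K)"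
    using haar open_UNIV unfolding left_haar_measure_def by blast
  moreover have "emeasure M UNIV \<noteq> 0" using haar unfolding left_haar_measure_def by blast
  ultimately show False by simp
qed

section \<open>Regularity, and separability of ranges almost everywhere\<close>

text \<open>Inner regularity is given for open sets only. For \<open>A\<close> of finite measure, a
  compact subset of an open \<open>U\<close> containing \<open>A\<close> may leave \<open>A\<close>;
  removing an open set of small measure that covers U - A brings it back inside and keeps it
  compact.\<close>

lemma haar_regular:
  assumes A: "A \<in> sets borel" "emeasure M A < \<infinity>" and e: "0 < (e::ennreal)"
  obtains K U where "compact K" "open U" "K \<subseteq> A" "A \<subseteq> U" "emeasure M (U - K) < e"
proof -
  have outer: "\<exists>U. open U \<and> A \<subseteq> U \<and> emeasure M (U - A) < e"
    if A: "A \<in> sets borel" "emeasure M A < \<infinity>" and e: "0 < e" for A and e :: ennreal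
  proof -
    have "(INF U\<in>{U. open U \<and> A \<subseteq> U}. emeasure M U) < emeasure M A + e"
      using haar A e unfolding left_haar_measure_def
      by (metis ennreal_add_left_cancel_less add.right_neutral less_irrefl infinity_ennreal_def)
    then obtain U where U: "open U" "A \<subseteq> U" "emeasure M U < emeasure M A + e"
      unfolding INF_less_iff by blast
    have "emeasure M U = emeasure M A + emeasure M (U - A)"
      using U A by (subst plus_emeasure) (auto simp: sets_haar Un_absorb1)
    thus ?thesis using U by (auto simp: ennreal_add_left_cancel_less)
  qed
  \<comment> \<open>Since \<open>e\<close> may be infinite, a finite value below it is
    halved.\<close>
  obtain y where y: "0 < y" "y < e" using dense[OF e] by blast
  then obtain r where r: "y = ennreal r" "0 < r" by (cases y) (auto simp: top_unique)
  define d where "d = ennreal (r / 2)"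
  have "d + d = y" using r by (simp add: d_def ennreal_plus[symmetric] del: ennreal_plus)
  hence d: "0 < d" "d < \<infinity>" "d + d \<le> e" using y r by (auto simp: d_def)
  obtain U where U: "open U" "A \<subseteq> U" "emeasure M (U - A) < d" using outer[OF A d(1)] by blast
  have "emeasure M U = emeasure M A + emeasure M (U - A)"
    using U A by (subst plus_emeasure) (auto simp: sets_haar Un_absorb1)
  hence finU: "emeasure M U < \<infinity>" using A U(3) by (auto simp: less_top[symmetric])
  obtain K where K: "compact K" "K \<subseteq> U" "emeasure M (U - K) < d"
  proof (cases "emeasure M U = 0")
    case True
    show thesis by (rule that[of "{}"]) (use True d in auto)
  next
    case False
    have "emeasure M U - d < emeasure M U"
      using False finU d by (intro ennreal_between) (auto simp: zero_less_iff_neq_zero)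
    also have "emeasure M U = (SUP K\<in>{K. compact K \<and> K \<subseteq> U}. emeasure M K)"
      using haar U unfolding left_haar_measure_def by blast
    finally obtain K where K: "compact K" "K \<subseteq> U" "emeasure M U - d < emeasure M K"
      unfolding less_SUP_iff by blast
    have Kb: "K \<in> sets M" using K by (simp add: sets_haar compact_imp_closed)
    have s: "emeasure M U = emeasure M K + emeasure M (U - K)"
      using U K Kb by (subst plus_emeasure) (auto simp: sets_haar Un_absorb1)
    have "emeasure M (U - K) < d"
    proof (rule ccontr)
      assume "\<not> emeasure M (U - K) < d"
      hence "emeasure M K + d \<le> emeasure M U" unfolding s by (intro add_left_mono) auto
      hence "emeasure M K \<le> emeasure M U - d" using d(2) by (simp add: ennreal_le_minus_iff)
      thus False using K(3) by simp
    qed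
    thus thesis using that K by blast
  qed
  \<comment> \<open>Outer regularity for U - A, whose measure is already below \<open>d\<close>. As
    K lies in U, the set K - V lies in A.\<close>
  obtain V where V: "open V" "U - A \<subseteq> V" "emeasure M V < d"
  proof -
    have "(INF V\<in>{V. open V \<and> U - A \<subseteq> V}. emeasure M V) < d"
      using haar A U unfolding left_haar_measure_def by (metis borel_open sets.Diff)
    thus thesis unfolding INF_less_iff using that by blast
  qed
  show thesis
  proof (rule that[of "K - V" U])
    show "compact (K - V)" using K V by (intro compact_diff)
    have "emeasure M (U - (K - V)) \<le> emeasure M ((U - K) \<union> V)"
      using U V K by (intro emeasure_mono) (auto simp: sets_haar compact_imp_closed)
    also have "\<dots> \<le> emeasure M (U - K) + emeasure M V"
      using U V K by (intro emeasure_subadditive) (auto simp: sets_haar compact_imp_closed)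
    also have "\<dots> < d + d" using K V by (intro add_strict_mono)
    also have "\<dots> \<le> e" by (rule d)
    finally show "emeasure M (U - (K - V)) < e" .
  qed (use U K V in auto)
qed

text \<open>By the Markov inequality the set where \<open>f\<close> is nonzero is a countable union
  of sets of finite measure. Compact subsets exhaust each of them up to a null set, and the
  continuous image of a compact set is separable.\<close>

lemma ae_separable_range:
  fixes F :: "'g \<Rightarrow> 'b::metric_space" and f :: "'g \<Rightarrow> complex"
  assumes F: "continuous_on UNIV F" and f: "integrable M f"
  obtains D where "countable D" "D \<subseteq> range F" "AE s in M. f s \<noteq> 0 \<longrightarrow> F s \<in> closure D"
proof -
  define A where "A n = {s. norm (f s) \<ge> 1 / real (Suc n)}" for n
  have [measurable]: "f \<in> borel_measurable M" using f by simp
  have A_meas: "A n \<in> sets M" for n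
  proof -
    have "{s \<in> space M. norm (f s) \<ge> 1 / real (Suc n)} \<in> sets M" by measurable
    thus ?thesis by (simp add: A_def space_haar)
  qed
  have A_fin: "emeasure M (A n) < \<infinity>" for n
  proof -
    have "emeasure M {s \<in> space M. norm (f s) \<ge> 1 / real (Suc n)}
        \<le> ennreal (1 / (1 / real (Suc n)) * (LINT s|M. norm (f s)))"
      using integral_Markov_inequality[of M "\<lambda>s. norm (f s)" "1 / real (Suc n)"] f by simp
    also have "\<dots> < \<infinity>" by simp
    finally show ?thesis by (simp add: A_def space_haar)
  qed
  have "\<exists>K. compact K \<and> K \<subseteq> A n \<and> emeasure M (A n - K) < ennreal (1 / real (Suc m))" for n m
  proof -
    obtain K U where KU: "compact K" "open U" "K \<subseteq> A n" "A n \<subseteq> U"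
      "emeasure M (U - K) < ennreal (1 / real (Suc m))"
      by (rule haar_regular[of "A n" "ennreal (1 / real (Suc m))"])
        (use A_meas A_fin sets_haar in auto)
    have "emeasure M (A n - K) \<le> emeasure M (U - K)"
      using KU by (intro emeasure_mono) (auto simp: sets_haar compact_imp_closed)
    thus ?thesis using KU by auto
  qed
  then obtain K where K: "\<And>n m. compact (K n m)" "\<And>n m. K n m \<subseteq> A n"
    "\<And>n m. emeasure M (A n - K n m) < ennreal (1 / real (Suc m))" by metis
  have "\<exists>D. countable D \<and> D \<subseteq> F ` K n m \<and> F ` K n m \<subseteq> closure D" for n m
    by (rule compact_countable_dense[OF compact_continuous_image[OF continuous_on_subset[OF F] K(1)[of n m]]])
      auto
  then obtain D where D: "\<And>n m. countable (D n m)" "\<And>n m. D n m \<subseteq> F ` K n m"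
    "\<And>n m. F ` K n m \<subseteq> closure (D n m)" by metis
  define N where "N n = A n - (\<Union>m. K n m)" for n
  have K_meas: "K n m \<in> sets M" for n m using K(1) by (simp add: sets_haar compact_imp_closed)
  have "N n \<in> null_sets M" for n
  proof (rule null_setsI)
    show "N n \<in> sets M" unfolding N_def using A_meas K_meas by auto
    have le: "emeasure M (N n) \<le> ennreal (1 / real (Suc m))" for m
    proof -
      have "emeasure M (N n) \<le> emeasure M (A n - K n m)"
        unfolding N_def using A_meas K_meas by (intro emeasure_mono) auto
      thus ?thesis using K(3)[of n m] by simp
    qed
    have "(\<lambda>m. ennreal (1 / real (Suc m))) \<longlonglongrightarrow> ennreal 0"
      by (intro tendsto_ennrealI LIMSEQ_Suc[OF lim_1_over_n])
    hence "emeasure M (N n) \<le> ennreal 0"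
      by (rule LIMSEQ_le_const) (use le in auto)
    thus "emeasure M (N n) = 0" by simp
  qed
  hence null: "(\<Union>n. N n) \<in> null_sets M" by auto
  show thesis
  proof (rule that[of "\<Union>n. \<Union>m. D n m"])
    show "countable (\<Union>n. \<Union>m. D n m)" using D(1) by (intro countable_UN) auto
    show "(\<Union>n. \<Union>m. D n m) \<subseteq> range F" using D(2) by fast
    show "AE s in M. f s \<noteq> 0 \<longrightarrow> F s \<in> closure (\<Union>n. \<Union>m. D n m)"
    proof (rule AE_I'[OF null], rule subsetI)
      fix s assume "s \<in> {s \<in> space M. \<not> (f s \<noteq> 0 \<longrightarrow> F s \<in> closure (\<Union>n. \<Union>m. D n m))}"
      hence s: "f s \<noteq> 0" "F s \<notin> closure (\<Union>n. \<Union>m. D n m)" by auto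
      from s(1) obtain n where n: "1 / real (Suc n) < norm (f s)"
        using nat_approx_posE[of "norm (f s)"] by auto
      have "s \<notin> K n m" for m
      proof
        assume "s \<in> K n m"
        hence "F s \<in> closure (D n m)" using D(3) by blast
        also have "\<dots> \<subseteq> closure (\<Union>n. \<Union>m. D n m)" by (intro closure_mono) auto
        finally show False using s(2) by simp
      qed
      thus "s \<in> (\<Union>n. N n)" using n by (auto simp: N_def A_def intro!: exI[of _ n])
    qed
  qed
qed

section \<open>Continuity of translation in L^1\<close>

text \<open>A tube argument: joint continuity of addition at (0, k) gives a product neighbourhood
  mapped into \<open>U\<close>; finitely many of the second factors cover \<open>K\<close>, and the
  corresponding first factors are intersected.\<close>

lemma eventually_translate_compact_subset:
  assumes K: "compact K" and U: "open U" "K \<subseteq> (U :: 'g set)"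
  shows "\<forall>\<^sub>F s in nhds 0. \<forall>k\<in>K. s + k \<in> U"
proof -
  have "\<exists>N W. open N \<and> 0 \<in> N \<and> open W \<and> k \<in> W \<and> (\<forall>s\<in>N. \<forall>t\<in>W. s + t \<in> U)" if "k \<in> K" for k
  proof -
    have "\<forall>\<^sub>F p in nhds 0 \<times>\<^sub>F nhds k. fst p + snd p \<in> U"
      using tendsto_add_Pair[of "0::'g" k] U that
      by (auto simp: filterlim_def le_filter_def eventually_filtermap intro: eventually_nhds_in_open)
    then obtain P Q where PQ: "eventually P (nhds 0)" "eventually Q (nhds k)"
      "\<And>s t. P s \<Longrightarrow> Q t \<Longrightarrow> s + t \<in> U"
      unfolding eventually_prod_filter by auto
    obtain N where N: "open N" "0 \<in> N" "\<forall>s\<in>N. P s"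
      using PQ(1) unfolding eventually_nhds by blast
    obtain W where W: "open W" "k \<in> W" "\<forall>t\<in>W. Q t"
      using PQ(2) unfolding eventually_nhds by blast
    have "\<forall>s\<in>N. \<forall>t\<in>W. s + t \<in> U" using PQ(3) N(3) W(3) by simp
    thus ?thesis using N(1,2) W(1,2) by blast
  qed
  hence "\<forall>k\<in>K. \<exists>N W. open N \<and> 0 \<in> N \<and> open W \<and> k \<in> W \<and> (\<forall>s\<in>N. \<forall>t\<in>W. s + t \<in> U)"
    by blast
  from bchoice[OF this] obtain N where "\<forall>k\<in>K. \<exists>W. open (N k) \<and> 0 \<in> N k \<and> open W \<and> k \<in> W \<and>
      (\<forall>s\<in>N k. \<forall>t\<in>W. s + t \<in> U)" ..
  from bchoice[OF this] obtain W where NW: "\<And>k. k \<in> K \<Longrightarrow> open (N k)" "\<And>k. k \<in> K \<Longrightarrow> 0 \<in> N k"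
    "\<And>k. k \<in> K \<Longrightarrow> open (W k)" "\<And>k. k \<in> K \<Longrightarrow> k \<in> W k"
    "\<And>k s t. k \<in> K \<Longrightarrow> s \<in> N k \<Longrightarrow> t \<in> W k \<Longrightarrow> s + t \<in> U" by blast
  obtain C where C: "C \<subseteq> K" "finite C" "K \<subseteq> (\<Union>k\<in>C. W k)"
    using compactE_image[OF K, of K W] NW(3,4) by blast
  have "\<forall>\<^sub>F s in nhds 0. \<forall>k\<in>C. s \<in> N k"
    using C NW(1,2) by (intro eventually_ball_finite ballI eventually_nhds_in_open) auto
  thus ?thesis by eventually_elim (use C NW(5) in blast)
qed

text \<open>For \<open>s\<close> near 0 both s + K and -s + K stay in \<open>U\<close>, so the two
  indicators can differ at \<open>t\<close> only if t or -s + t lies in U - K. By left invariance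
  each case contributes the measure of U - K, less than e / 2.\<close>

lemma translation_continuous_indicator:
  assumes A: "A \<in> sets M" "emeasure M A < \<infinity>"
  shows "((\<lambda>s. LINT t|M. \<bar>indicat_real A (- s + t) - indicat_real A t\<bar>) \<longlongrightarrow> 0) (nhds 0)"
proof (rule tendstoI)
  fix e :: real assume e: "e > 0"
  obtain K U where KU: "compact K" "open U" "K \<subseteq> A" "A \<subseteq> U" "emeasure M (U - K) < ennreal (e / 2)"
    by (rule haar_regular[of A "ennreal (e / 2)"]) (use A e sets_haar in auto)
  define B where "B = U - K"
  have B_meas: "B \<in> sets M" using KU by (simp add: B_def sets_haar compact_imp_closed)
  have B_fin: "emeasure M B < \<infinity>" using KU(5) unfolding B_def by (rule order_less_trans) simp
  have B_small: "measure M B < e / 2"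
    using KU(5) e B_fin unfolding B_def measure_def
    by (metis enn2real_less_iff half_gt_zero infinity_ennreal_def less_top top.not_eq_extremum enn2real_positive_iff
        ennreal_enn2real ennreal_less_iff enn2real_nonneg)
  have int_B: "integrable M (indicat_real B)" and int_A: "integrable M (indicat_real A)"
    using B_meas B_fin A by (auto simp: integrable_indicator_iff space_haar)
  note int_B' = haar_integrable_translate[OF int_B] and int_A' = haar_integrable_translate[OF int_A]
  have ev: "\<forall>\<^sub>F s in nhds 0. \<forall>k\<in>K. s + k \<in> U"
    using KU by (intro eventually_translate_compact_subset) auto
  have "filterlim uminus (nhds 0) (nhds (0::'g))" using tendsto_uminus_nhds[of "0::'g"] by simp
  from filterlim_iff[THEN iffD1, OF this, rule_format, OF ev]
  have ev': "\<forall>\<^sub>F s in nhds 0. \<forall>k\<in>K. - s + k \<in> U" .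
  show "\<forall>\<^sub>F s in nhds 0. dist (LINT t|M. \<bar>indicat_real A (- s + t) - indicat_real A t\<bar>) 0 < e"
    using ev ev'
  proof eventually_elim
    case (elim s)
    have le: "\<bar>indicat_real A (- s + t) - indicat_real A t\<bar> \<le> indicat_real B (- s + t) + indicat_real B t" for t
    proof -
      have t: "s + (- s + t) = t" by (simp add: add.assoc[symmetric])
      have "t \<in> U" if "- s + t \<in> K" using elim(1) that t by metis
      moreover have "- s + t \<in> U" if "t \<in> K" using elim(2) that by blast
      ultimately show ?thesis using KU(3,4) by (auto simp: indicator_def B_def)
    qed
    have "(LINT t|M. \<bar>indicat_real A (- s + t) - indicat_real A t\<bar>)
        \<le> (LINT t|M. indicat_real B (- s + t) + indicat_real B t)"
      by (rule integral_mono) (use le int_A int_A' int_B int_B' in auto)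
    also have "\<dots> = (LINT t|M. indicat_real B (- s + t)) + (LINT t|M. indicat_real B t)"
      by (rule Bochner_Integration.integral_add[OF int_B' int_B])
    also have "\<dots> = measure M B + measure M B"
      using B_meas by (subst haar_integral_translate) (auto simp: space_haar)
    also have "\<dots> < e" using B_small by simp
    finally show ?case by simp
  qed
qed

text \<open>Translation is isometric on L^1, so approximating \<open>f\<close> by \<open>g i\<close>
  costs the same error before and after translating; the limit case is the resulting three-term
  estimate.\<close>

lemma translation_continuous_L1:
  fixes f :: "'g \<Rightarrow> complex"
  assumes "integrable M f"
  shows "((\<lambda>s. LINT t|M. norm (f (- s + t) - f t)) \<longlongrightarrow> 0) (nhds 0)"
  using assms
proof (induction f rule: integrable_induct)
  case (base A c)
  have "norm (indicat_real A (- s + t) *\<^sub>R c - indicat_real A t *\<^sub>R c)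
      = \<bar>indicat_real A (- s + t) - indicat_real A t\<bar> * norm c" for s t
    by (simp flip: scaleR_diff_left)
  thus ?case
    using tendsto_mult_left_zero[OF translation_continuous_indicator[OF base], of "norm c"] by simp
next
  case (add f g)
  note int = haar_integrable_translate[OF add.hyps(1)] haar_integrable_translate[OF add.hyps(2)] add.hyps
  show ?case
  proof (rule tendsto_sandwich[OF _ _ tendsto_const tendsto_add_zero[OF add.IH]])
    show "\<forall>\<^sub>F s in nhds 0. (LINT t|M. norm (f (- s + t) + g (- s + t) - (f t + g t)))
        \<le> (LINT t|M. norm (f (- s + t) - f t)) + (LINT t|M. norm (g (- s + t) - g t))"
    proof (intro always_eventually allI)
      fix s
      have "norm (f (- s + t) + g (- s + t) - (f t + g t)) \<le> norm (f (- s + t) - f t) + norm (g (- s + t) - g t)" for t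
        by norm
      hence "(LINT t|M. norm (f (- s + t) + g (- s + t) - (f t + g t)))
          \<le> (LINT t|M. norm (f (- s + t) - f t) + norm (g (- s + t) - g t))"
        using int by (intro integral_mono) auto
      also have "\<dots> = (LINT t|M. norm (f (- s + t) - f t)) + (LINT t|M. norm (g (- s + t) - g t))"
        using int by (intro Bochner_Integration.integral_add) auto
      finally show "(LINT t|M. norm (f (- s + t) + g (- s + t) - (f t + g t)))
        \<le> (LINT t|M. norm (f (- s + t) - f t)) + (LINT t|M. norm (g (- s + t) - g t))" .
    qed
  qed (auto intro!: always_eventually Bochner_Integration.integral_nonneg)
next
  case (lim f g)
  have [measurable]: "f \<in> borel_measurable M" "\<And>i. g i \<in> borel_measurable M" using lim.hyps by auto
  have "(\<lambda>i. LINT t|M. norm (g i t - f t)) \<longlonglongrightarrow> (LINT t|M. norm (0::complex))"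
  proof (rule integral_dominated_convergence[where w="\<lambda>t. 3 * norm (f t)"])
    show "AE t in M. (\<lambda>i. norm (g i t - f t)) \<longlonglongrightarrow> norm (0::complex)"
      using lim.hyps(2) by (intro AE_I2 tendsto_norm LIM_zero) auto
    \<comment> \<open>The approximants of the induction principle satisfy |g_i| \<le> 2 |f|; adding
      |f| gives the factor 3.\<close>
    show "AE t in M. norm (norm (g i t - f t)) \<le> 3 * norm (f t)" for i
    proof (rule AE_I2)
      fix t assume "t \<in> space M"
      from lim.hyps(3)[OF this, of i] show "norm (norm (g i t - f t)) \<le> 3 * norm (f t)"
        using norm_triangle_ineq4[of "g i t" "f t"] by simp
    qed
  qed (use lim.hyps in auto)
  hence small: "(\<lambda>i. LINT t|M. norm (g i t - f t)) \<longlonglongrightarrow> 0" by simp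
  show ?case
  proof (rule tendstoI)
    fix e :: real assume e: "e > 0"
    from order_tendstoD(2)[OF small, of "e / 3"] e
    obtain i where i: "(LINT t|M. norm (g i t - f t)) < e / 3"
      by (auto simp: eventually_sequentially)
    have "\<forall>\<^sub>F s in nhds 0. (LINT t|M. norm (g i (- s + t) - g i t)) < e / 3"
      by (rule order_tendstoD(2)[OF lim.IH]) (use e in simp)
    thus "\<forall>\<^sub>F s in nhds 0. dist (LINT t|M. norm (f (- s + t) - f t)) 0 < e"
    proof eventually_elim
      case (elim s)
      note int = haar_integrable_translate[OF lim.hyps(4), of "-s"] haar_integrable_translate[OF lim.hyps(1)[of i], of "-s"]
        lim.hyps(4) lim.hyps(1)[of i]
      have "norm (f (- s + t) - f t) \<le> norm (g i (- s + t) - f (- s + t))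
          + norm (g i (- s + t) - g i t) + norm (g i t - f t)" for t
        by norm
      hence "(LINT t|M. norm (f (- s + t) - f t)) \<le> (LINT t|M. norm (g i (- s + t) - f (- s + t))
          + norm (g i (- s + t) - g i t) + norm (g i t - f t))"
        using int by (intro integral_mono) auto
      also have "\<dots> = (LINT t|M. norm (g i (- s + t) - f (- s + t)))
          + (LINT t|M. norm (g i (- s + t) - g i t)) + (LINT t|M. norm (g i t - f t))"
        using int by simp
      also have "(LINT t|M. norm (g i (- s + t) - f (- s + t))) = (LINT t|M. norm (g i t - f t))"
        by (rule haar_integral_translate) measurable
      also have "\<dots> + (LINT t|M. norm (g i (- s + t) - g i t)) + (LINT t|M. norm (g i t - f t)) < e"
        using i elim by simp
      finally show ?case by simp
    qed
  qed
qed

end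

section \<open>Haar-integrated unitary representations\<close>

lemma norm_le_cinnerI:
  fixes A :: "'h::complex_hilbert_space \<Rightarrow>\<^sub>L 'h"
  assumes "0 \<le> C" "\<And>x y. cmod (cinner (blinfun_apply A x) y) \<le> C * norm x * norm y"
  shows "norm A \<le> C"
proof (rule norm_blinfun_bound[OF assms(1)])
  fix x
  let ?y = "blinfun_apply A x"
  show "norm ?y \<le> C * norm x"
  proof (cases "?y = 0")
    case False
    have "norm ?y * norm ?y = cmod (cinner ?y ?y)"
      by (simp add: cinner_self_eq_norm power2_eq_square norm_mult)
    also have "\<dots> \<le> C * norm x * norm ?y" by (rule assms(2))
    finally show ?thesis using False by simp
  qed (use assms(1) in simp)
qed

lemma blinfun_compose_assoc: "(S o\<^sub>L T) o\<^sub>L U = S o\<^sub>L (T o\<^sub>L U)"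
  by (rule blinfun_eqI) simp

lemma cinner_adj_left:
  "T \<in> bounded_ops \<Longrightarrow> cinner (blinfun_apply (adj T) x) y = cinner x (blinfun_apply T y)"
  by (metis cinner_adj cinner_commute)

text \<open>Bounded linear maps of type \<open>'h \<Rightarrow>\<^sub>L 'h\<close> carry real scalar
  multiplication only; a complex multiple is expressed as a composition with this operator.\<close>

definition scale_op :: "complex \<Rightarrow> ('h::complex_hilbert_space \<Rightarrow>\<^sub>L 'h)" where
  "scale_op c = Blinfun (\<lambda>x. c *\<^sub>C x)"

lemma scale_op_apply [simp]: "blinfun_apply (scale_op c) x = c *\<^sub>C x"
  unfolding scale_op_def by (simp add: bounded_linear_Blinfun_apply bounded_linear_scaleC)

lemma norm_scale_op_le: "norm (scale_op c) \<le> cmod c"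
  by (rule norm_blinfun_bound) (auto simp: norm_scaleC)

lemma predual_scale_op:
  assumes "\<omega> \<in> predual"
  shows "\<omega> (scale_op c o\<^sub>L T) = c * \<omega> T"
proof -
  obtain x y where w: "\<And>T. \<omega> T = (\<Sum>n. cinner (blinfun_apply T (x n)) (y n))"
    and s: "\<And>T. summable (\<lambda>n. norm (cinner (blinfun_apply T (x n)) (y n)))"
    by (rule predualE[OF assms]) blast
  show ?thesis
    unfolding w by (simp add: cinner_scaleC_left suminf_mult[OF summable_norm_cancel[OF s]])
qed

text \<open>Row-column Cauchy-Schwarz: a coefficient of the sum equals the sum of the inner products
  of w_i x with v_i^* y, and the squared norms of these vectors add up to quadratic forms of the two
  given operators. The bound is sqrt d from each side.\<close>

lemma norm_sum_compose_le:
  fixes v w :: "'i \<Rightarrow> ('h::complex_hilbert_space \<Rightarrow>\<^sub>L 'h)"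
  assumes v: "\<And>i. i \<in> G \<Longrightarrow> v i \<in> bounded_ops" and w: "\<And>i. i \<in> G \<Longrightarrow> w i \<in> bounded_ops"
    and a: "norm (\<Sum>i\<in>G. v i o\<^sub>L adj (v i)) \<le> d" and b: "norm (\<Sum>i\<in>G. adj (w i) o\<^sub>L w i) \<le> d"
  shows "norm (\<Sum>i\<in>G. v i o\<^sub>L w i) \<le> d"
proof (rule norm_le_cinnerI)
  show d: "0 \<le> d" using a norm_ge_zero order_trans by blast
  \<comment> \<open>Used for t = w with q = w^* w, and for t = v^* with q = v v^*.\<close>
  have quad: "(\<Sum>i\<in>G. (norm (blinfun_apply (t i) x))\<^sup>2) \<le> (sqrt d * norm x)\<^sup>2"
    if "norm (\<Sum>i\<in>G. q i) \<le> d"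
      "\<And>i. i \<in> G \<Longrightarrow> cinner (blinfun_apply (q i) x) x = cinner (blinfun_apply (t i) x) (blinfun_apply (t i) x)"
    for t q :: "'i \<Rightarrow> ('h \<Rightarrow>\<^sub>L 'h)" and x
  proof -
    have "(\<Sum>i\<in>G. (norm (blinfun_apply (t i) x))\<^sup>2) = Re (\<Sum>i\<in>G. cinner (blinfun_apply (q i) x) x)"
      using that(2) by (simp add: cinner_self_eq_norm)
    also have "\<dots> = Re (cinner (blinfun_apply (\<Sum>i\<in>G. q i) x) x)"
      by (simp add: blinfun.sum_left bounded_bilinear.sum_left[OF bounded_bilinear_cinner])
    also have "\<dots> \<le> norm (blinfun_apply (\<Sum>i\<in>G. q i) x) * norm x" by (rule Re_cinner_le)
    also have "\<dots> \<le> norm (\<Sum>i\<in>G. q i) * norm x * norm x"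
      by (intro mult_right_mono norm_blinfun) auto
    also have "\<dots> \<le> d * norm x * norm x" using that(1) by (intro mult_right_mono) auto
    also have "\<dots> = (sqrt d * norm x)\<^sup>2"
      using d unfolding power_mult_distrib by (simp add: power2_eq_square[of "norm x"] mult.assoc)
    finally show ?thesis .
  qed
  fix x y
  let ?a = "\<lambda>i. norm (blinfun_apply (w i) x)" and ?b = "\<lambda>i. norm (blinfun_apply (adj (v i)) y)"
  have wx: "(\<Sum>i\<in>G. (?a i)\<^sup>2) \<le> (sqrt d * norm x)\<^sup>2"
    by (rule quad[OF b]) (simp add: w cinner_adj_left)
  have vy: "(\<Sum>i\<in>G. (?b i)\<^sup>2) \<le> (sqrt d * norm y)\<^sup>2"
    by (rule quad[OF a]) (simp add: v cinner_adj)
  have "cmod (cinner (blinfun_apply (\<Sum>i\<in>G. v i o\<^sub>L w i) x) y)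
      = cmod (\<Sum>i\<in>G. cinner (blinfun_apply (w i) x) (blinfun_apply (adj (v i)) y))"
    by (simp add: blinfun.sum_left bounded_bilinear.sum_left[OF bounded_bilinear_cinner] v cinner_adj)
  also have "\<dots> \<le> (\<Sum>i\<in>G. \<bar>?a i\<bar> * \<bar>?b i\<bar>)"
    by (rule sum_norm_le) (simp add: cinner_norm_le)
  also have "\<dots> \<le> L2_set ?a G * L2_set ?b G" by (rule L2_set_mult_ineq)
  also have "\<dots> \<le> (sqrt d * norm x) * (sqrt d * norm y)"
  proof (rule mult_mono)
    show "L2_set ?a G \<le> sqrt d * norm x"
      unfolding L2_set_def by (rule real_le_lsqrt[OF _ wx]) (use d in \<open>auto intro: sum_nonneg\<close>)
    show "L2_set ?b G \<le> sqrt d * norm y"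
      unfolding L2_set_def by (rule real_le_lsqrt[OF _ vy]) (use d in \<open>auto intro: sum_nonneg\<close>)
  qed (use d in \<open>auto simp: L2_set_nonneg\<close>)
  also have "\<dots> = d * norm x * norm y" using d by simp
  finally show "cmod (cinner (blinfun_apply (\<Sum>i\<in>G. v i o\<^sub>L w i) x) y) \<le> d * norm x * norm y" .
qed

lemma summable_on_tail_small:
  fixes a :: "'i \<Rightarrow> 'b::real_normed_vector"
  assumes "a summable_on I" "0 < d"
  obtains P where "finite P" "P \<subseteq> I" "\<And>G. finite G \<Longrightarrow> G \<subseteq> I - P \<Longrightarrow> norm (sum a G) \<le> d"
proof -
  obtain S where S: "(sum a \<longlongrightarrow> S) (finite_subsets_at_top I)"
    using assms(1) by (auto simp: summable_on_def has_sum_def)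
  from tendstoD[OF S, of "d / 2"] assms(2)
  obtain P where P: "finite P" "P \<subseteq> I"
    "\<And>Q. finite Q \<Longrightarrow> P \<subseteq> Q \<Longrightarrow> Q \<subseteq> I \<Longrightarrow> dist (sum a Q) S < d / 2"
    unfolding eventually_finite_subsets_at_top by auto
  show thesis
  proof (rule that[OF P(1,2)])
    fix G assume G: "finite G" "G \<subseteq> I - P"
    have "sum a (P \<union> G) = sum a P + sum a G" using G P by (intro sum.union_disjoint) auto
    hence "norm (sum a G) = dist (sum a (P \<union> G)) (sum a P)" by (simp add: dist_norm)
    also have "\<dots> \<le> dist (sum a (P \<union> G)) S + dist (sum a P) S" by (rule dist_triangle2)
    also have "\<dots> \<le> d" using P(3)[of "P \<union> G"] P(3)[of P] P(1,2) G by force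
    finally show "norm (sum a G) \<le> d" .
  qed
qed

text \<open>Outside a finite set both tails are small in norm, so the row-column estimate bounds the
  partial sums of v_i w_i beyond \<open>P\<close> uniformly. Their weak* limit \<open>A\<close>
  inherits the bound through its coefficients.\<close>

lemma haagerup_series_norm_approx:
  fixes v w :: "'i \<Rightarrow> ('h::complex_hilbert_space \<Rightarrow>\<^sub>L 'h)"
  assumes vw: "\<And>i. i \<in> I \<Longrightarrow> v i \<in> bounded_ops" "\<And>i. i \<in> I \<Longrightarrow> w i \<in> bounded_ops"
    and sv: "(\<lambda>i. v i o\<^sub>L adj (v i)) summable_on I" and sw: "(\<lambda>i. adj (w i) o\<^sub>L w i) summable_on I"
    and A: "wstar_has_sum (\<lambda>i. v i o\<^sub>L w i) A I" and e: "0 < e"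
  obtains P where "finite P" "P \<subseteq> I" "norm (A - (\<Sum>i\<in>P. v i o\<^sub>L w i)) \<le> e"
proof -
  obtain P1 where P1: "finite P1" "P1 \<subseteq> I"
    "\<And>G. finite G \<Longrightarrow> G \<subseteq> I - P1 \<Longrightarrow> norm (\<Sum>i\<in>G. v i o\<^sub>L adj (v i)) \<le> e"
    using summable_on_tail_small[OF sv e] by blast
  obtain P2 where P2: "finite P2" "P2 \<subseteq> I"
    "\<And>G. finite G \<Longrightarrow> G \<subseteq> I - P2 \<Longrightarrow> norm (\<Sum>i\<in>G. adj (w i) o\<^sub>L w i) \<le> e"
    using summable_on_tail_small[OF sw e] by blast
  define P where "P = P1 \<union> P2"
  have P: "finite P" "P \<subseteq> I" using P1 P2 by (auto simp: P_def)
  let ?S = "\<lambda>Q. \<Sum>i\<in>Q. v i o\<^sub>L w i"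
  have tail: "norm (?S Q - ?S P) \<le> e" if "finite Q" "P \<subseteq> Q" "Q \<subseteq> I" for Q
  proof -
    have "?S Q - ?S P = ?S (Q - P)" using that by (simp add: sum_diff)
    also have "norm \<dots> \<le> e"
    proof (rule norm_sum_compose_le)
      show "norm (\<Sum>i\<in>Q - P. v i o\<^sub>L adj (v i)) \<le> e" using that by (intro P1) (auto simp: P_def)
      show "norm (\<Sum>i\<in>Q - P. adj (w i) o\<^sub>L w i) \<le> e" using that by (intro P2) (auto simp: P_def)
    qed (use vw that in auto)
    finally show ?thesis .
  qed
  have "norm (A - ?S P) \<le> e"
  proof (rule norm_le_cinnerI)
    fix x y :: 'h
    let ?w = "\<lambda>T. cinner (blinfun_apply T x) y"
    have lin: "bounded_linear ?w" by (rule bounded_linear_predual[OF rank_one_predual])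
    have "((\<lambda>i. ?w (v i o\<^sub>L w i)) has_sum ?w A) I"
      using A bspec[OF _ rank_one_predual[of x y]] unfolding wstar_has_sum_def by fast
    hence "((\<lambda>Q. ?w (?S Q)) \<longlongrightarrow> ?w A) (finite_subsets_at_top I)"
      unfolding has_sum_def linear_sum[OF bounded_linear.linear[OF lin]] by simp
    hence "((\<lambda>Q. cmod (?w (?S Q - ?S P))) \<longlongrightarrow> cmod (?w (A - ?S P))) (finite_subsets_at_top I)"
      unfolding linear_diff[OF bounded_linear.linear[OF lin]] by (intro tendsto_intros)
    moreover have "\<forall>\<^sub>F Q in finite_subsets_at_top I. cmod (?w (?S Q - ?S P)) \<le> e * norm x * norm y"
      unfolding eventually_finite_subsets_at_top
    proof (intro exI[of _ P] conjI allI impI P)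
      fix Q assume Q: "finite Q \<and> P \<subseteq> Q \<and> Q \<subseteq> I"
      have "cmod (?w (?S Q - ?S P)) \<le> norm (blinfun_apply (?S Q - ?S P) x) * norm y"
        by (rule cinner_norm_le)
      also have "\<dots> \<le> norm (?S Q - ?S P) * norm x * norm y"
        by (intro mult_right_mono norm_blinfun) auto
      also have "\<dots> \<le> e * norm x * norm y" using tail Q by (intro mult_right_mono) auto
      finally show "cmod (?w (?S Q - ?S P)) \<le> e * norm x * norm y" .
    qed
    ultimately show "cmod (?w (A - ?S P)) \<le> e * norm x * norm y"
      by (rule tendsto_upperbound) simp
  qed (use e in simp)
  thus thesis using that P by blast
qed

section \<open>The representation, its integrated form and the algebra generated by it\<close>

locale haar_unitary_rep =
  fixes \<pi> :: "'g::{topological_group_add,t2_space} \<Rightarrow> ('h::complex_hilbert_space \<Rightarrow>\<^sub>L 'h)"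
    and M :: "'g measure"
  assumes haar: "left_haar_measure M" and rep: "unitary_rep \<pi>" and strong: "strongly_continuous \<pi>"
begin

lemma rep_bounded_ops: "\<pi> s \<in> bounded_ops"
  using rep by (simp add: unitary_rep_def unitary_ops_def)

lemma rep_add: "\<pi> (s + t) = \<pi> s o\<^sub>L \<pi> t"
  using rep by (simp add: unitary_rep_def)

lemma rep_adj_left: "adj (\<pi> s) o\<^sub>L \<pi> s = id_blinfun" and rep_adj_right: "\<pi> s o\<^sub>L adj (\<pi> s) = id_blinfun"
  using rep by (auto simp: unitary_rep_def unitary_ops_def)

lemma rep_zero: "\<pi> 0 = id_blinfun"
proof -
  have "\<pi> 0 = (adj (\<pi> 0) o\<^sub>L \<pi> 0) o\<^sub>L \<pi> 0"
    by (simp add: rep_adj_left blinfun_eqI)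
  also have "\<dots> = adj (\<pi> 0) o\<^sub>L \<pi> (0 + 0)" by (simp only: rep_add blinfun_compose_assoc)
  finally show ?thesis by (simp add: rep_adj_left)
qed

text \<open>Makes the adjoint another value of the representation; this is how \<pi>(s)^* enters
  \<open>Cstar M \<pi>\<close> and how its coefficients become continuous.\<close>

lemma adj_rep: "adj (\<pi> s) = \<pi> (- s)"
proof -
  have "adj (\<pi> s) = adj (\<pi> s) o\<^sub>L (\<pi> s o\<^sub>L \<pi> (- s))"
    by (simp add: rep_zero blinfun_eqI flip: rep_add)
  also have "\<dots> = \<pi> (- s)"
    by (simp add: rep_adj_left blinfun_eqI flip: blinfun_compose_assoc)
  finally show ?thesis .
qed

lemma cinner_rep: "cinner (blinfun_apply (\<pi> s) x) y = cinner x (blinfun_apply (\<pi> (- s)) y)"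
  by (simp add: cinner_adj[OF rep_bounded_ops] adj_rep)

lemma norm_rep_le: "norm (\<pi> s) \<le> 1"
proof (rule norm_blinfun_bound)
  fix x
  have "complex_of_real ((norm (blinfun_apply (\<pi> s) x))\<^sup>2)
      = cinner (blinfun_apply (\<pi> s) x) (blinfun_apply (\<pi> s) x)"
    by (simp add: cinner_self_eq_norm)
  also have "\<dots> = cinner x (blinfun_apply (\<pi> (- s) o\<^sub>L \<pi> s) x)" by (simp add: cinner_rep)
  also have "\<dots> = complex_of_real ((norm x)\<^sup>2)"
    by (simp add: rep_zero cinner_self_eq_norm flip: rep_add)
  finally have "(norm (blinfun_apply (\<pi> s) x))\<^sup>2 = (norm x)\<^sup>2" using of_real_eq_iff by blast
  thus "norm (blinfun_apply (\<pi> s) x) \<le> 1 * norm x" by (simp add: power2_eq_iff_nonneg)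
qed simp

lemma norm_rep_compose_le: "norm (\<pi> s o\<^sub>L T) \<le> norm T"
  by (rule order_trans[OF norm_blinfun_compose]) (use mult_right_mono[OF norm_rep_le, of "norm T"] in simp)

lemma continuous_rep_apply: "continuous_on UNIV (\<lambda>s. blinfun_apply (\<pi> s) x)"
  using strong by (simp add: strongly_continuous_def)

lemma continuous_rep_apply_minus: "continuous_on UNIV (\<lambda>s. blinfun_apply (\<pi> (- s)) x)"
  by (rule continuous_on_compose2[OF continuous_rep_apply[of x], where f=uminus])
    (intro continuous_on_minus continuous_on_id, simp)

lemma borel_measurable_haarI: "continuous_on UNIV g \<Longrightarrow> g \<in> borel_measurable M"
  for g :: "'g \<Rightarrow> 'b::topological_space"
  by (simp add: borel_measurable_continuous_onI measurable_cong_sets[OF sets_haar[OF haar] refl])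

lemma rep_coefficient_measurable:
  "(\<lambda>s. cinner (blinfun_apply (\<pi> s) x) y) \<in> borel_measurable M"
  by (intro borel_measurable_haarI continuous_intros continuous_rep_apply)

text \<open>Moving \<pi>(s) to the second slot leaves an inner product of two norm continuous vector
  functions, T \<pi>(-s) x and \<pi>(-s) y.\<close>

lemma conj_coefficient_measurable:
  "(\<lambda>s. cinner (blinfun_apply (\<pi> s o\<^sub>L T o\<^sub>L adj (\<pi> s)) x) y) \<in> borel_measurable M"
  by (simp add: adj_rep cinner_rep)
    (intro borel_measurable_haarI continuous_intros continuous_rep_apply_minus)

lemma norm_conj_le: "norm (\<pi> s o\<^sub>L T o\<^sub>L adj (\<pi> s)) \<le> norm T"
proof -
  have "norm (\<pi> s o\<^sub>L T o\<^sub>L adj (\<pi> s)) \<le> norm (\<pi> s o\<^sub>L T) * norm (\<pi> (- s))"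
    unfolding adj_rep by (rule norm_blinfun_compose)
  also have "\<dots> \<le> norm T * 1" by (intro mult_mono norm_rep_compose_le norm_rep_le) auto
  finally show ?thesis by simp
qed

lemma conj_bounded_ops: "T \<in> bounded_ops \<Longrightarrow> \<pi> s o\<^sub>L T o\<^sub>L adj (\<pi> s) \<in> bounded_ops"
  by (auto simp: adj_rep intro!: rep_bounded_ops)

lemmas pi1_bounded = wstar_integral_bounded[OF rep_bounded_ops norm_rep_le rep_coefficient_measurable,
    folded pi1_def]

lemmas Gamma_integral = wstar_integral_bounded[OF conj_bounded_ops norm_conj_le conj_coefficient_measurable]

lemma rep_coefficient_integrable:
  "integrable M f \<Longrightarrow> integrable M (\<lambda>s. cinner (blinfun_apply (\<pi> s) x) y * f s)"
  using pi1_bounded(2)[OF _ rank_one_predual] .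

lemma cinner_pi1:
  "integrable M f \<Longrightarrow> cinner (blinfun_apply (pi1 M \<pi> f) x) y
    = (LINT s|M. cinner (blinfun_apply (\<pi> s) x) y * f s)"
  using pi1_bounded(3)[OF _ rank_one_predual] .

lemma pi1_add:
  assumes "integrable M f" "integrable M g"
  shows "pi1 M \<pi> (\<lambda>s. f s + g s) = pi1 M \<pi> f + pi1 M \<pi> g"
  by (rule blinfun_eq_cinnerI)
    (use assms in \<open>simp add: cinner_pi1 blinfun.add_left cinner_add_left ring_distribs rep_coefficient_integrable\<close>)

lemma pi1_cmult:
  assumes "integrable M f"
  shows "pi1 M \<pi> (\<lambda>s. c * f s) = scale_op c o\<^sub>L pi1 M \<pi> f"
proof (rule blinfun_eq_cinnerI)
  fix x y
  have "cinner (blinfun_apply (pi1 M \<pi> (\<lambda>s. c * f s)) x) y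
      = (LINT s|M. c * (cinner (blinfun_apply (\<pi> s) x) y * f s))"
    using assms by (simp add: cinner_pi1 mult.left_commute)
  thus "cinner (blinfun_apply (pi1 M \<pi> (\<lambda>s. c * f s)) x) y
      = cinner (blinfun_apply (scale_op c o\<^sub>L pi1 M \<pi> f) x) y"
    using assms by (simp add: cinner_pi1 cinner_scaleC_left)
qed

text \<open>Left invariance under the substitution of -s + t for t. This converts left
  multiplication by \<pi>(s) into translation on L^1.\<close>

lemma rep_compose_pi1:
  assumes f: "integrable M f"
  shows "\<pi> s o\<^sub>L pi1 M \<pi> f = pi1 M \<pi> (\<lambda>t. f (- s + t))"
proof (rule blinfun_eq_cinnerI)
  fix x y
  note f' = haar_integrable_translate[OF haar f, of "-s"]
  have [measurable]: "f \<in> borel_measurable M" using f by simp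
  have "cinner (blinfun_apply (\<pi> s o\<^sub>L pi1 M \<pi> f) x) y
      = (LINT t|M. cinner (blinfun_apply (\<pi> (s + t)) x) y * f t)"
    using f by (simp add: cinner_rep[of s] cinner_pi1 rep_add)
  also have "\<dots> = (LINT t|M. cinner (blinfun_apply (\<pi> (s + (- s + t))) x) y * f (- s + t))"
  proof (rule haar_integral_translate[OF haar, symmetric])
    show "(\<lambda>t. cinner (blinfun_apply (\<pi> (s + t)) x) y * f t) \<in> borel_measurable M"
      using measurable_compose[OF measurable_add_left[OF haar, of s] rep_coefficient_measurable[of x y]]
      by measurable
  qed
  also have "\<dots> = cinner (blinfun_apply (pi1 M \<pi> (\<lambda>t. f (- s + t))) x) y"
    using f' by (simp add: cinner_pi1 add.assoc[symmetric])
  finally show "cinner (blinfun_apply (\<pi> s o\<^sub>L pi1 M \<pi> f) x) y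
    = cinner (blinfun_apply (pi1 M \<pi> (\<lambda>t. f (- s + t))) x) y" .
qed

lemma subspace_pi1_image: "subspace (pi1 M \<pi> ` L1 M)"
proof (rule subspaceI)
  have "pi1 M \<pi> (\<lambda>s. 0) = 0"
    by (rule blinfun_eq_cinnerI) (simp add: cinner_pi1)
  thus "0 \<in> pi1 M \<pi> ` L1 M" by (intro image_eqI[of _ _ "\<lambda>s. 0"]) (auto simp: L1_def)
next
  fix S T assume "S \<in> pi1 M \<pi> ` L1 M" "T \<in> pi1 M \<pi> ` L1 M"
  then obtain f g where "integrable M f" "integrable M g" "S = pi1 M \<pi> f" "T = pi1 M \<pi> g"
    by (auto simp: L1_def)
  thus "S + T \<in> pi1 M \<pi> ` L1 M"
    by (intro image_eqI[of _ _ "\<lambda>s. f s + g s"]) (auto simp: L1_def pi1_add)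
next
  fix r S assume "S \<in> pi1 M \<pi> ` L1 M"
  then obtain f where f: "integrable M f" "S = pi1 M \<pi> f" by (auto simp: L1_def)
  have "r *\<^sub>R S = scale_op (of_real r) o\<^sub>L S"
    by (rule blinfun_eqI) (simp add: blinfun.scaleR_left scaleC_of_real)
  thus "r *\<^sub>R S \<in> pi1 M \<pi> ` L1 M"
    using f by (intro image_eqI[of _ _ "\<lambda>s. of_real r * f s"]) (auto simp: L1_def pi1_cmult)
qed

lemma subspace_Cstar: "subspace (Cstar M \<pi>)"
  unfolding Cstar_def
proof (rule subspaceI)
  show "0 \<in> closure (pi1 M \<pi> ` L1 M)"
    by (rule subsetD[OF closure_subset subspace_0[OF subspace_pi1_image]])
next
  fix S T assume "S \<in> closure (pi1 M \<pi> ` L1 M)" "T \<in> closure (pi1 M \<pi> ` L1 M)"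
  then obtain a b where "\<And>n. a n \<in> pi1 M \<pi> ` L1 M" "a \<longlonglongrightarrow> S" "\<And>n. b n \<in> pi1 M \<pi> ` L1 M" "b \<longlonglongrightarrow> T"
    unfolding closure_sequential by blast
  thus "S + T \<in> closure (pi1 M \<pi> ` L1 M)"
    unfolding closure_sequential
    by (intro exI[of _ "\<lambda>n. a n + b n"]) (auto intro!: subspace_add[OF subspace_pi1_image] tendsto_add)
next
  fix r S assume "S \<in> closure (pi1 M \<pi> ` L1 M)"
  then obtain a where "\<And>n. a n \<in> pi1 M \<pi> ` L1 M" "a \<longlonglongrightarrow> S"
    unfolding closure_sequential by blast
  thus "r *\<^sub>R S \<in> closure (pi1 M \<pi> ` L1 M)"
    unfolding closure_sequential
    by (intro exI[of _ "\<lambda>n. r *\<^sub>R a n"]) (auto intro!: subspace_scale[OF subspace_pi1_image] tendsto_intros)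
qed

lemma Cstar_bounded_ops: "Cstar M \<pi> \<subseteq> bounded_ops"
  unfolding Cstar_def
  by (rule closure_minimal[OF _ closed_bounded_ops]) (auto simp: L1_def intro: pi1_bounded(1))

text \<open>\<open>subspace\<close> speaks of real scalars, whereas the coefficients in the
  expansion of \<open>Gamma_rep\<close> are complex; left composition with \<open>scale_op\<close>
  is continuous and preserves the dense image of L^1.\<close>

lemma scale_op_Cstar:
  assumes "T \<in> Cstar M \<pi>"
  shows "scale_op c o\<^sub>L T \<in> Cstar M \<pi>"
proof -
  have "(\<lambda>T. scale_op c o\<^sub>L T) ` closure (pi1 M \<pi> ` L1 M) \<subseteq> closure (pi1 M \<pi> ` L1 M)"
  proof (rule image_closure_subset)
    show "continuous_on (closure (pi1 M \<pi> ` L1 M)) (\<lambda>T. scale_op c o\<^sub>L T)"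
      by (intro linear_continuous_on bounded_bilinear.bounded_linear_right[OF bounded_bilinear_blinfun_compose])
    have "scale_op c o\<^sub>L pi1 M \<pi> f \<in> pi1 M \<pi> ` L1 M" if "integrable M f" for f
      using that by (intro image_eqI[of _ _ "\<lambda>s. c * f s"]) (auto simp: L1_def pi1_cmult)
    thus "(\<lambda>T. scale_op c o\<^sub>L T) ` (pi1 M \<pi> ` L1 M) \<subseteq> closure (pi1 M \<pi> ` L1 M)"
      using closure_subset by (fastforce simp: L1_def)
  qed simp
  thus ?thesis using assms unfolding Cstar_def by blast
qed

section \<open>Norm continuous left translation, and the implication from (iii) to (i)\<close>

text \<open>The operators on which left translation by \<open>\<pi>\<close> is norm continuous form a closed right
  ideal.\<close>

definition left_continuous_ops :: "('h \<Rightarrow>\<^sub>L 'h) set" where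
  "left_continuous_ops = {A. ((\<lambda>s. norm ((\<pi> s o\<^sub>L A) - A)) \<longlongrightarrow> 0) (nhds 0)}"

lemma compose_diff_left: "(S - T) o\<^sub>L A = (S o\<^sub>L A) - (T o\<^sub>L A)"
  and compose_diff_right: "S o\<^sub>L (A - B) = (S o\<^sub>L A) - (S o\<^sub>L B)"
  for S T A B :: "'h \<Rightarrow>\<^sub>L 'h"
  by (auto intro!: blinfun_eqI simp: blinfun.diff_left blinfun.diff_right)

lemma left_continuous_ops_compose:
  assumes "A \<in> left_continuous_ops"
  shows "A o\<^sub>L T \<in> left_continuous_ops"
proof -
  have le: "norm ((\<pi> s o\<^sub>L (A o\<^sub>L T)) - (A o\<^sub>L T)) \<le> norm ((\<pi> s o\<^sub>L A) - A) * norm T" for s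
    using norm_blinfun_compose[of "(\<pi> s o\<^sub>L A) - A" T]
    by (simp add: compose_diff_left blinfun_compose_assoc)
  have lim: "((\<lambda>s. norm ((\<pi> s o\<^sub>L A) - A) * norm T) \<longlongrightarrow> 0) (nhds 0)"
    using assms by (intro tendsto_mult_left_zero) (simp add: left_continuous_ops_def)
  have "((\<lambda>s. norm ((\<pi> s o\<^sub>L (A o\<^sub>L T)) - (A o\<^sub>L T))) \<longlongrightarrow> 0) (nhds 0)"
    by (rule Lim_null_comparison[OF always_eventually lim]) (use le in simp)
  thus ?thesis by (simp add: left_continuous_ops_def)
qed

lemma left_continuous_ops_sum:
  assumes "\<And>i. i \<in> P \<Longrightarrow> A i \<in> left_continuous_ops"
  shows "sum A P \<in> left_continuous_ops"
proof -
  have le: "norm ((\<pi> s o\<^sub>L sum A P) - sum A P) \<le> (\<Sum>i\<in>P. norm ((\<pi> s o\<^sub>L A i) - A i))" for s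
  proof -
    have "(\<pi> s o\<^sub>L sum A P) - sum A P = (\<Sum>i\<in>P. (\<pi> s o\<^sub>L A i) - A i)"
      by (simp add: bounded_bilinear.sum_right[OF bounded_bilinear_blinfun_compose] sum_subtractf)
    thus ?thesis using norm_sum by metis
  qed
  have lim: "((\<lambda>s. \<Sum>i\<in>P. norm ((\<pi> s o\<^sub>L A i) - A i)) \<longlongrightarrow> 0) (nhds 0)"
    using assms by (intro tendsto_null_sum) (simp add: left_continuous_ops_def)
  have "((\<lambda>s. norm ((\<pi> s o\<^sub>L sum A P) - sum A P)) \<longlongrightarrow> 0) (nhds 0)"
    by (rule Lim_null_comparison[OF always_eventually lim]) (use le in simp)
  thus ?thesis by (simp add: left_continuous_ops_def)
qed

text \<open>Closedness in approximation form: \<pi>(s) is a contraction, so replacing A by B costs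
  at most twice the norm of A - B, uniformly in s.\<close>

lemma left_continuous_ops_approx:
  assumes "\<And>e. e > 0 \<Longrightarrow> \<exists>B\<in>left_continuous_ops. norm (A - B) \<le> e"
  shows "A \<in> left_continuous_ops"
proof -
  have "((\<lambda>s. norm ((\<pi> s o\<^sub>L A) - A)) \<longlongrightarrow> 0) (nhds 0)"
  proof (rule tendstoI)
    fix e :: real assume e: "e > 0"
    obtain B where B: "B \<in> left_continuous_ops" "norm (A - B) \<le> e / 4"
      using assms[of "e / 4"] e by auto
    have "\<forall>\<^sub>F s in nhds 0. norm ((\<pi> s o\<^sub>L B) - B) < e / 4"
      by (rule order_tendstoD(2)) (use B e in \<open>auto simp: left_continuous_ops_def\<close>)
    thus "\<forall>\<^sub>F s in nhds 0. dist (norm ((\<pi> s o\<^sub>L A) - A)) 0 < e"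
    proof eventually_elim
      case (elim s)
      have eq: "(\<pi> s o\<^sub>L A) - A = (\<pi> s o\<^sub>L (A - B)) + ((\<pi> s o\<^sub>L B) - B) - (A - B)"
        by (simp add: compose_diff_right)
      have "norm ((\<pi> s o\<^sub>L A) - A) \<le> norm (\<pi> s o\<^sub>L (A - B)) + norm ((\<pi> s o\<^sub>L B) - B) + norm (A - B)"
        unfolding eq using norm_triangle_ineq4[of "(\<pi> s o\<^sub>L (A - B)) + ((\<pi> s o\<^sub>L B) - B)" "A - B"]
          norm_triangle_ineq[of "\<pi> s o\<^sub>L (A - B)" "(\<pi> s o\<^sub>L B) - B"] by linarith
      also have "\<dots> < e" using norm_rep_compose_le[of s "A - B"] elim B(2) e by simp
      finally show ?case by simp
    qed
  qed
  thus ?thesis by (simp add: left_continuous_ops_def)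
qed

text \<open>The difference is the integrated form of (translate of f) - f, and the integrated form
  is bounded by the L^1 norm.\<close>

lemma pi1_left_continuous:
  assumes f: "integrable M f"
  shows "pi1 M \<pi> f \<in> left_continuous_ops"
proof -
  have "norm ((\<pi> s o\<^sub>L pi1 M \<pi> f) - pi1 M \<pi> f) \<le> (LINT t|M. norm (f (- s + t) - f t))" for s
  proof -
    note f' = haar_integrable_translate[OF haar f, of "-s"]
    have "pi1 M \<pi> (\<lambda>t. f (- s + t)) = pi1 M \<pi> (\<lambda>t. f (- s + t) - f t) + pi1 M \<pi> f"
      using pi1_add[of "\<lambda>t. f (- s + t) - f t" f] f f' by simp
    hence "(\<pi> s o\<^sub>L pi1 M \<pi> f) - pi1 M \<pi> f = pi1 M \<pi> (\<lambda>t. f (- s + t) - f t)"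
      unfolding rep_compose_pi1[OF f] by (simp only: add_diff_cancel_right')
    thus ?thesis using pi1_bounded(4)[of "\<lambda>t. f (- s + t) - f t"] f f' by simp
  qed
  hence "((\<lambda>s. norm ((\<pi> s o\<^sub>L pi1 M \<pi> f) - pi1 M \<pi> f)) \<longlongrightarrow> 0) (nhds 0)"
    by (intro Lim_null_comparison[OF always_eventually translation_continuous_L1[OF haar f]]) auto
  thus ?thesis by (simp add: left_continuous_ops_def)
qed

lemma Cstar_left_continuous: "Cstar M \<pi> \<subseteq> left_continuous_ops"
proof
  fix A assume A: "A \<in> Cstar M \<pi>"
  show "A \<in> left_continuous_ops"
  proof (rule left_continuous_ops_approx)
    fix e :: real assume "e > 0"
    with A obtain f where "integrable M f" "dist (pi1 M \<pi> f) A < e"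
      unfolding Cstar_def closure_approachable by (auto simp: L1_def)
    thus "\<exists>B\<in>left_continuous_ops. norm (A - B) \<le> e"
      by (intro bexI[of _ "pi1 M \<pi> f"]) (auto simp: dist_norm norm_minus_commute pi1_left_continuous)
  qed
qed

text \<open>Continuity at 0 spreads to every t because \<pi>(s) - \<pi>(t) = \<pi>(t) (\<pi>(-t + s)
  - 1) and \<pi>(t) is a contraction.\<close>

lemma norm_continuous_if_id_left_continuous:
  assumes "id_blinfun \<in> left_continuous_ops"
  shows "norm_continuous \<pi>"
  unfolding norm_continuous_def continuous_on_eq_continuous_at[OF open_UNIV] continuous_at
proof (intro ballI tendstoI)
  fix t :: 'g and e :: real assume e: "e > 0"
  have id: "T o\<^sub>L id_blinfun = T" for T :: "'h \<Rightarrow>\<^sub>L 'h" by (rule blinfun_eqI) simp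
  have "((\<lambda>s. norm (\<pi> s - id_blinfun)) \<longlongrightarrow> 0) (nhds 0)"
    using assms unfolding left_continuous_ops_def mem_Collect_eq id .
  from order_tendstoD(2)[OF this e]
  have ev: "\<forall>\<^sub>F s in nhds 0. norm (\<pi> s - id_blinfun) < e" .
  have "((\<lambda>s. - t + s) \<longlongrightarrow> - t + t) (at t)" by (intro tendsto_intros)
  hence "filterlim (\<lambda>s. - t + s) (nhds 0) (at t)" by simp
  from filterlim_iff[THEN iffD1, OF this, rule_format, OF ev]
  show "\<forall>\<^sub>F s in at t. dist (\<pi> s) (\<pi> t) < e"
  proof eventually_elim
    case (elim s)
    have "\<pi> s = \<pi> t o\<^sub>L \<pi> (- t + s)" by (simp add: add.assoc[symmetric] flip: rep_add)
    hence "\<pi> s - \<pi> t = \<pi> t o\<^sub>L (\<pi> (- t + s) - id_blinfun)" by (simp add: compose_diff_right id)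
    thus ?case using norm_rep_compose_le[of t "\<pi> (- t + s) - id_blinfun"] elim by (simp add: dist_norm)
  qed
qed

lemma norm_continuous_if_Gamma_haagerup:
  assumes f: "f \<in> L1 M - augmentation_ideal M" and T: "Gamma_rep M \<pi> f \<in> Cstar M \<pi> \<otimes>h Cstar M \<pi>"
  shows "norm_continuous \<pi>"
proof -
  define c where "c = (LINT s|M. f s)"
  have int: "integrable M f" and c: "c \<noteq> 0"
    using f by (auto simp: L1_def augmentation_ideal_def c_def)
  have id: "T o\<^sub>L id_blinfun = T" for T :: "'h \<Rightarrow>\<^sub>L 'h" by (rule blinfun_eqI) simp
  have Gid: "Gamma_rep M \<pi> f id_blinfun = scale_op c"
  proof (rule blinfun_eq_cinnerI)
    fix x y
    have "cinner (blinfun_apply (Gamma_rep M \<pi> f id_blinfun) x) y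
        = (LINT s|M. cinner (blinfun_apply (\<pi> s o\<^sub>L id_blinfun o\<^sub>L adj (\<pi> s)) x) y * f s)"
      unfolding Gamma_rep_def using Gamma_integral(3)[OF id_in_bounded_ops int rank_one_predual] by simp
    thus "cinner (blinfun_apply (Gamma_rep M \<pi> f id_blinfun) x) y
        = cinner (blinfun_apply (scale_op c) x) y"
      by (simp only: id rep_adj_right) (simp add: cinner_scaleC_left c_def mult.commute)
  qed
  obtain I :: "('h \<times> nat) set" and v w where eh: "eh_series (Cstar M \<pi>) (Cstar M \<pi>) I v w (Gamma_rep M \<pi> f)"
    and s: "(\<lambda>i. v i o\<^sub>L adj (v i)) summable_on I" "(\<lambda>i. adj (w i) o\<^sub>L w i) summable_on I"
    using T unfolding haagerup_tensor_def by blast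
  have vw: "\<And>i. i \<in> I \<Longrightarrow> v i \<in> Cstar M \<pi>" "\<And>i. i \<in> I \<Longrightarrow> w i \<in> Cstar M \<pi>"
    using eh by (auto simp: eh_series_def)
  hence bo: "\<And>i. i \<in> I \<Longrightarrow> v i \<in> bounded_ops" "\<And>i. i \<in> I \<Longrightarrow> w i \<in> bounded_ops"
    using Cstar_bounded_ops by auto
  have ws: "wstar_has_sum (\<lambda>i. v i o\<^sub>L w i) (scale_op c) I"
    using eh id_in_bounded_ops unfolding eh_series_def Gid[symmetric] by (metis (no_types, lifting) ext id)
  have "scale_op c \<in> left_continuous_ops"
  proof (rule left_continuous_ops_approx)
    fix e :: real assume e: "e > 0"
    obtain P where P: "finite P" "P \<subseteq> I" "norm (scale_op c - (\<Sum>i\<in>P. v i o\<^sub>L w i)) \<le> e"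
      by (rule haagerup_series_norm_approx[OF bo s ws e])
    \<comment> \<open>Each left factor \<open>v i\<close> lies in the right ideal, hence so does
      \<open>v i o\<^sub>L w i\<close>; closedness then carries membership to the norm
      limit.\<close>
    have "(\<Sum>i\<in>P. v i o\<^sub>L w i) \<in> left_continuous_ops"
      using P vw Cstar_left_continuous
      by (intro left_continuous_ops_sum left_continuous_ops_compose) blast
    thus "\<exists>B\<in>left_continuous_ops. norm (scale_op c - B) \<le> e" using P by blast
  qed
  hence "scale_op c o\<^sub>L scale_op (1 / c) \<in> left_continuous_ops" by (rule left_continuous_ops_compose)
  moreover have "scale_op c o\<^sub>L scale_op (1 / c) = (id_blinfun :: 'h \<Rightarrow>\<^sub>L 'h)"
    using c scaleC_of_real[of 1] by (intro blinfun_eqI) (simp add: scaleC_scaleC)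
  ultimately show ?thesis by (intro norm_continuous_if_id_left_continuous) simp
qed

end

section \<open>The implications from (i) to (ii) and from (ii) to (iii)\<close>

text \<open>The point where local compactness enters: it supplies integrable indicators of open
  neighbourhoods.\<close>

lemma haar_open_finite_nhd:
  fixes M :: "'g::{topological_group_add,t2_space} measure"
  assumes lc: "locally_compact_space (euclidean :: 'g topology)" and haar: "left_haar_measure M"
  obtains U where "open U" "s \<in> U" "emeasure M U < \<infinity>"
proof -
  obtain U K where UK: "open U" "compact K" "s \<in> U" "U \<subseteq> K"
    using lc unfolding locally_compact_space_def by simp metis
  have "emeasure M U \<le> emeasure M K"
    using UK by (intro emeasure_mono) (auto simp: sets_haar[OF haar] compact_imp_closed)
  also have "\<dots> < \<infinity>" using emeasure_haar_compact[OF haar UK(2)] .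
  finally show thesis using that UK by blast
qed

text \<open>The first \<open>n\<close> coded pairs lie in a finite rectangle; the terms are
  nonnegative, so the sum over the rectangle dominates, and that sum factors.\<close>

lemma sum_prod_decode_le:
  fixes a b :: "nat \<Rightarrow> real"
  assumes a: "a summable_on UNIV" "\<And>i. 0 \<le> a i" and b: "b summable_on UNIV" "\<And>i. 0 \<le> b i"
  shows "(\<Sum>p<n. a (fst (prod_decode p)) * b (snd (prod_decode p)))
    \<le> infsum a UNIV * infsum b UNIV"
proof -
  define P where "P = prod_decode ` {..<n}"
  have fin: "finite P" by (simp add: P_def)
  have "(\<Sum>p<n. a (fst (prod_decode p)) * b (snd (prod_decode p))) = (\<Sum>(i,j)\<in>P. a i * b j)"
    unfolding P_def by (subst sum.reindex) (auto simp: inj_prod_decode o_def case_prod_unfold)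
  also have "\<dots> \<le> (\<Sum>(i,j)\<in>fst ` P \<times> snd ` P. a i * b j)"
    using fin a(2) b(2) by (intro sum_mono2) (auto intro: rev_image_eqI)
  also have "\<dots> = sum a (fst ` P) * sum b (snd ` P)"
    by (simp add: sum_product sum.cartesian_product)
  also have "\<dots> \<le> infsum a UNIV * infsum b UNIV"
    using fin a b by (intro mult_mono finite_sum_le_infsum infsum_nonneg sum_nonneg) auto
  finally show ?thesis .
qed

context haar_unitary_rep
begin

text \<open>The averages of \<open>\<pi>\<close> over small neighbourhoods of \<open>s\<close> converge in norm to \<open>\<pi> s\<close>.\<close>

lemma rep_in_Cstar:
  assumes lc: "locally_compact_space (euclidean :: 'g topology)" and nc: "norm_continuous \<pi>"
  shows "\<pi> s \<in> Cstar M \<pi>"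
  unfolding Cstar_def closure_approachable
proof (intro allI impI)
  fix e :: real assume e: "e > 0"
  obtain U where U: "open U" "s \<in> U" "emeasure M U < \<infinity>"
    using haar_open_finite_nhd[OF lc haar] by blast
  define N where "N = U \<inter> \<pi> -` ball (\<pi> s) (e / 2)"
  have "open N" unfolding N_def
    using nc U by (intro open_Int open_vimage) (auto simp: norm_continuous_def)
  moreover have "s \<in> N" using U e by (simp add: N_def)
  ultimately have pos: "emeasure M N \<noteq> 0" by (intro haar_open_pos[OF haar]) auto
  have N_sets: "N \<in> sets M" using \<open>open N\<close> by (simp add: sets_haar[OF haar])
  have "emeasure M N \<le> emeasure M U"
    using U by (intro emeasure_mono) (auto simp: N_def sets_haar[OF haar])
  hence fin: "emeasure M N < \<infinity>" using U(3) by (rule order_le_less_trans)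
  define m where "m = measure M N"
  have m: "m > 0" using pos fin
    by (simp add: m_def measure_def enn2real_positive_iff zero_less_iff_neq_zero)
  have intN: "integrable M (indicat_real N)"
    using N_sets fin by (simp add: integrable_indicator_iff space_haar[OF haar])
  \<comment> \<open>Normalised to integral 1, so that subtracting \<pi>(s) from the average can be
    done under the integral, where the difference is below e / 2 on \<open>N\<close>.\<close>
  define f where "f t = complex_of_real (indicat_real N t / m)" for t
  have int: "integrable M f"
    unfolding f_def by (intro integrable_of_real integrable_divide intN)
  have int_f: "(LINT t|M. f t) = 1"
    unfolding f_def using m N_sets by (simp add: m_def space_haar[OF haar])
  have norm_f: "(LINT t|M. norm (f t)) = 1"
    unfolding f_def norm_of_real using m N_sets by (simp add: m_def space_haar[OF haar])
  have "norm (pi1 M \<pi> f - \<pi> s) \<le> e / 2"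
  proof (rule norm_le_cinnerI)
    fix x y
    let ?h = "\<lambda>t. cinner (blinfun_apply (\<pi> t - \<pi> s) x) y * f t"
    have h: "integrable M ?h"
      using rep_coefficient_integrable[OF int, of x y] int
      by (simp add: blinfun.diff_left cinner_diff_left left_diff_distrib)
    have "cinner (blinfun_apply (pi1 M \<pi> f - \<pi> s) x) y = (LINT t|M. ?h t)"
      using rep_coefficient_integrable[OF int, of x y] int
      by (simp add: blinfun.diff_left cinner_diff_left left_diff_distrib cinner_pi1 int_f)
    also have "cmod \<dots> \<le> (LINT t|M. norm (?h t))" by (rule integral_norm_bound)
    also have "\<dots> \<le> (LINT t|M. e / 2 * norm x * norm y * norm (f t))"
    proof (rule integral_mono)
      fix t
      show "norm (?h t) \<le> e / 2 * norm x * norm y * norm (f t)"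
      proof (cases "t \<in> N")
        case True
        have "cmod (cinner (blinfun_apply (\<pi> t - \<pi> s) x) y) \<le> norm (blinfun_apply (\<pi> t - \<pi> s) x) * norm y"
          by (rule cinner_norm_le)
        also have "\<dots> \<le> norm (\<pi> t - \<pi> s) * norm x * norm y"
          by (intro mult_right_mono norm_blinfun) auto
        also have "\<dots> \<le> e / 2 * norm x * norm y"
          using True by (intro mult_right_mono) (auto simp: N_def dist_norm norm_minus_commute)
        finally show ?thesis unfolding norm_mult by (rule mult_right_mono) simp
      qed (simp add: f_def)
    qed (use h int in auto)
    finally show "cmod (cinner (blinfun_apply (pi1 M \<pi> f - \<pi> s) x) y) \<le> e / 2 * norm x * norm y"
      by (simp add: norm_f)
  qed (use e in simp)
  thus "\<exists>y\<in>pi1 M \<pi> ` L1 M. dist y (\<pi> s) < e"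
    using e int by (intro bexI[of _ "pi1 M \<pi> f"]) (auto simp: dist_norm L1_def)
qed

text \<open>A countable dense part of the essential range of \<open>F\<close> is enumerated and fed
  to the expansion; the operators \<open>d j\<close> are differences of its values and so stay in
  \<open>V\<close>.\<close>

lemma countably_valued_expansion_ae:
  fixes F :: "'g \<Rightarrow> ('h \<Rightarrow>\<^sub>L 'h)" and f :: "'g \<Rightarrow> complex"
  assumes F: "continuous_on UNIV F" "\<And>s. norm (F s) \<le> 1" "\<And>s. F s \<in> V"
    and V: "subspace V" and f: "integrable M f"
  obtains E d where "\<And>j::nat. E j \<in> sets M" "\<And>j. d j \<in> V"
    "AE s in M. f s \<noteq> 0 \<longrightarrow> ((\<lambda>j. indicat_real (E j) s *\<^sub>R d j) has_sum F s) UNIV \<and>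
      (\<lambda>j. norm (indicat_real (E j) s *\<^sub>R d j)) summable_on UNIV \<and>
      (\<Sum>\<^sub>\<infinity>j. norm (indicat_real (E j) s *\<^sub>R d j)) \<le> 6"
proof -
  obtain D where D: "countable D" "D \<subseteq> range F" "AE s in M. f s \<noteq> 0 \<longrightarrow> F s \<in> closure D"
    by (rule ae_separable_range[OF haar F(1) f])
  \<comment> \<open>The leading 0 provides the start value \<open>e 0 = 0\<close>; inserting 0 into
    \<open>D\<close> makes the enumerated set nonempty.\<close>
  define e where "e n = (case n of 0 \<Rightarrow> 0 | Suc m \<Rightarrow> from_nat_into (insert 0 D) m)" for n
  have "e n \<in> insert 0 D" for n
    unfolding e_def using from_nat_into[of "insert 0 D"] by (auto split: nat.split)
  moreover have "insert 0 D \<subseteq> V" using D(2) F(3) subspace_0[OF V] by auto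
  ultimately have eV: "e n \<in> V" for n by (rule subsetD[rotated])
  have "D \<subseteq> range e"
  proof
    fix x assume "x \<in> D"
    then obtain m where "from_nat_into (insert 0 D) m = x"
      using from_nat_into_surj[of "insert 0 D" x] D(1) by auto
    thus "x \<in> range e" by (intro image_eqI[of _ _ "Suc m"]) (auto simp: e_def)
  qed
  hence cl: "closure D \<subseteq> closure (range e)" by (rule closure_mono)
  have e0: "e 0 = 0" by (simp add: e_def)
  obtain E d where Ed: "\<And>j::nat. E j \<in> sets borel" "\<And>j. \<exists>m n. d j = e m - e n"
    "\<And>s. F s \<in> closure (range e) \<Longrightarrow>
      ((\<lambda>j. indicat_real (E j) s *\<^sub>R d j) has_sum F s) UNIV"
    "\<And>s. F s \<in> closure (range e) \<Longrightarrow>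
      (\<lambda>j. norm (indicat_real (E j) s *\<^sub>R d j)) summable_on UNIV"
    "\<And>s. F s \<in> closure (range e) \<Longrightarrow>
      (\<Sum>\<^sub>\<infinity>j. norm (indicat_real (E j) s *\<^sub>R d j)) \<le> 6"
    by (rule countably_valued_expansion[of F e, OF F(1) e0 F(2)]) blast
  show thesis
  proof (rule that)
    show "E j \<in> sets M" for j using Ed(1) by (simp add: sets_haar[OF haar])
    show "d j \<in> V" for j using Ed(2)[of j] eV subspace_diff[OF V] by auto
    show "AE s in M. f s \<noteq> 0 \<longrightarrow> ((\<lambda>j. indicat_real (E j) s *\<^sub>R d j) has_sum F s) UNIV \<and>
      (\<lambda>j. norm (indicat_real (E j) s *\<^sub>R d j)) summable_on UNIV \<and>
      (\<Sum>\<^sub>\<infinity>j. norm (indicat_real (E j) s *\<^sub>R d j)) \<le> 6"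
      using D(3) by eventually_elim (use cl Ed(3-5) in blast)
  qed
qed

lemma Gamma_haagerup_if_norm_continuous:
  assumes lc: "locally_compact_space (euclidean :: 'g topology)" and nc: "norm_continuous \<pi>"
    and f: "f \<in> L1 M"
  shows "Gamma_rep M \<pi> f \<in> Cstar M \<pi> \<otimes>h Cstar M \<pi>"
proof -
  have int: "integrable M f" using f by (simp add: L1_def)
  have cont: "continuous_on UNIV \<pi>" using nc by (simp add: norm_continuous_def)
  have cont': "continuous_on UNIV (\<lambda>s. \<pi> (- s))"
    by (rule continuous_on_compose2[OF cont, where f=uminus])
      (intro continuous_on_minus continuous_on_id, simp)
  obtain E d where E: "\<And>j::nat. E j \<in> sets M" and d: "\<And>j. d j \<in> Cstar M \<pi>"
    and aeE: "AE s in M. f s \<noteq> 0 \<longrightarrow> ((\<lambda>j. indicat_real (E j) s *\<^sub>R d j) has_sum \<pi> s) UNIV \<and>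
      (\<lambda>j. norm (indicat_real (E j) s *\<^sub>R d j)) summable_on UNIV \<and>
      (\<Sum>\<^sub>\<infinity>j. norm (indicat_real (E j) s *\<^sub>R d j)) \<le> 6"
    by (rule countably_valued_expansion_ae[OF cont norm_rep_le rep_in_Cstar[OF lc nc] subspace_Cstar int]) blast
  obtain E' d' where E': "\<And>j::nat. E' j \<in> sets M" and d': "\<And>j. d' j \<in> Cstar M \<pi>"
    and aeE': "AE s in M. f s \<noteq> 0 \<longrightarrow> ((\<lambda>j. indicat_real (E' j) s *\<^sub>R d' j) has_sum \<pi> (- s)) UNIV \<and>
      (\<lambda>j. norm (indicat_real (E' j) s *\<^sub>R d' j)) summable_on UNIV \<and>
      (\<Sum>\<^sub>\<infinity>j. norm (indicat_real (E' j) s *\<^sub>R d' j)) \<le> 6"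
    by (rule countably_valued_expansion_ae[OF cont' norm_rep_le rep_in_Cstar[OF lc nc] subspace_Cstar int]) blast
  \<comment> \<open>A single natural number \<open>p\<close> codes the pair of indices from the two
    expansions.\<close>
  define k l where "k p = fst (prod_decode p)" and "l p = snd (prod_decode p)" for p
  define \<phi> where "\<phi> p = indicat_real (E (k p) \<inter> E' (l p))" for p
  have int_\<phi>: "integrable M (\<lambda>s. complex_of_real (\<phi> p s) * f s)" for p
  proof -
    have "E (k p) \<inter> E' (l p) \<in> sets M" using E E' by auto
    from integrable_mult_indicator[OF this int] show ?thesis
      by (simp add: \<phi>_def scaleR_conv_of_real)
  qed
  define c where "c p = (LINT s|M. complex_of_real (\<phi> p s) * f s)" for p
  \<comment> \<open>The complex coefficient is absorbed into the left factor.\<close>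
  define v where "v p = scale_op (c p) o\<^sub>L d (k p)" for p
  define w where "w p = d' (l p)" for p
  \<comment> \<open>The common majorant of the \<open>p\<close>-th term: it controls both the norms
    of the tensor factors and the scalar integrands below.\<close>
  define g where "g p s = \<phi> p s * (norm (d (k p)) * norm (d' (l p))) * norm (f s)" for p s
  have int_g: "integrable M (g p)" for p
    using integrable_mult_right[OF integrable_norm[OF int_\<phi>[of p]], of "norm (d (k p)) * norm (d' (l p))"]
    by (simp add: g_def[abs_def] norm_mult \<phi>_def mult_ac)
  have g_nonneg: "0 \<le> g p s" for p s by (simp add: g_def \<phi>_def)
  \<comment> \<open>36 is the product of the absolute bounds 6 of the two expansions. These hold
    only where \<open>f\<close> is nonzero; elsewhere \<open>g\<close> vanishes.\<close>
  have ae_g: "AE s in M. \<forall>n. (\<Sum>p<n. g p s) \<le> 36 * norm (f s)"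
    using aeE aeE'
  proof eventually_elim
    case (elim s)
    show ?case
    proof (cases "f s = 0")
      case False
      let ?a = "\<lambda>i. norm (indicat_real (E i) s *\<^sub>R d i)" and ?b = "\<lambda>j. norm (indicat_real (E' j) s *\<^sub>R d' j)"
      have a: "?a summable_on UNIV" "infsum ?a UNIV \<le> 6" and b: "?b summable_on UNIV" "infsum ?b UNIV \<le> 6"
        using elim False by auto
      have "(\<Sum>p<n. ?a (k p) * ?b (l p)) \<le> 36" for n
      proof -
        have "(\<Sum>p<n. ?a (k p) * ?b (l p)) \<le> infsum ?a UNIV * infsum ?b UNIV"
          unfolding k_def l_def by (rule sum_prod_decode_le) (use a b in auto)
        also have "\<dots> \<le> 6 * 6" using a b by (intro mult_mono infsum_nonneg) auto
        finally show ?thesis by simp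
      qed
      hence "(\<Sum>p<n. ?a (k p) * ?b (l p)) * norm (f s) \<le> 36 * norm (f s)" for n
        by (intro mult_right_mono) auto
      moreover have "g p s = ?a (k p) * ?b (l p) * norm (f s)" for p
        by (simp add: g_def \<phi>_def indicator_inter_arith)
      ultimately show ?thesis by (simp add: sum_distrib_right)
    qed (simp add: g_def)
  qed
  \<comment> \<open>The terms are nonnegative, so it suffices that the partial sums stay below the
    integral of 36 |f|.\<close>
  have sum_g: "summable (\<lambda>p. LINT s|M. g p s)"
  proof (rule bounded_imp_summable)
    show "0 \<le> (LINT s|M. g p s)" for p by (rule Bochner_Integration.integral_nonneg) (rule g_nonneg)
    fix n
    have "(\<Sum>p\<le>n. LINT s|M. g p s) = (LINT s|M. (\<Sum>p\<le>n. g p s))"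
      using int_g by (subst Bochner_Integration.integral_sum) auto
    also have "\<dots> \<le> (LINT s|M. 36 * norm (f s))"
    proof (rule integral_mono_AE)
      show "AE s in M. (\<Sum>p\<le>n. g p s) \<le> 36 * norm (f s)"
        using ae_g by eventually_elim (simp only: lessThan_Suc_atMost[symmetric])
    qed (use int_g int in auto)
    finally show "(\<Sum>p\<le>n. LINT s|M. g p s) \<le> (LINT s|M. 36 * norm (f s))" .
  qed
  have norm_vw: "norm (v p) * norm (w p) \<le> (LINT s|M. g p s)" for p
  proof -
    have "norm (v p) \<le> cmod (c p) * norm (d (k p))"
      unfolding v_def by (rule order_trans[OF norm_blinfun_compose]) (intro mult_right_mono norm_scale_op_le, simp)
    moreover have "cmod (c p) \<le> (LINT s|M. norm (complex_of_real (\<phi> p s) * f s))"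
      unfolding c_def by (rule integral_norm_bound)
    ultimately have "norm (v p) \<le> (LINT s|M. norm (complex_of_real (\<phi> p s) * f s)) * norm (d (k p))"
      by (meson mult_right_mono norm_ge_zero order_trans)
    hence "norm (v p) * norm (w p)
        \<le> (LINT s|M. norm (complex_of_real (\<phi> p s) * f s)) * norm (d (k p)) * norm (w p)"
      by (rule mult_right_mono) simp
    also have "\<dots> = (LINT s|M. norm (complex_of_real (\<phi> p s) * f s) * (norm (d (k p)) * norm (w p)))"
      by (simp add: mult.assoc)
    also have "\<dots> = (LINT s|M. g p s)"
      by (rule Bochner_Integration.integral_cong) (auto simp: g_def w_def norm_mult \<phi>_def mult_ac)
    finally show ?thesis .
  qed
  show ?thesis
  proof (rule haagerup_tensorI[of _ _ v w])
    show "v p \<in> Cstar M \<pi>" for p unfolding v_def by (rule scale_op_Cstar[OF d])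
    show "w p \<in> Cstar M \<pi>" for p unfolding w_def by (rule d')
    show "summable (\<lambda>p. norm (v p) * norm (w p))"
      by (rule summable_comparison_test'[OF sum_g, where N=0]) (simp add: norm_vw)
    show "Gamma_rep M \<pi> f \<in> bounded_ops \<rightarrow>\<^sub>E bounded_ops"
      unfolding Gamma_rep_def using Gamma_integral(1)[OF _ int] by auto
    fix x :: "'h \<Rightarrow>\<^sub>L 'h" and \<omega> :: "('h \<Rightarrow>\<^sub>L 'h) \<Rightarrow> complex"
    assume x: "x \<in> bounded_ops" and \<omega>: "\<omega> \<in> predual"
    \<comment> \<open>The \<open>p\<close>-th term of
      \<open>\<omega> (\<pi> s o\<^sub>L x o\<^sub>L adj (\<pi> s)) * f s\<close> after both
      expansions are substituted; its integral is the \<open>p\<close>-th term of the tensor series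
      evaluated at \<open>x\<close>.\<close>
    define h where "h p s = \<omega> (d (k p) o\<^sub>L x o\<^sub>L d' (l p)) * (complex_of_real (\<phi> p s) * f s)" for p s
    obtain K where K: "K \<ge> 0" "\<And>S. norm (\<omega> S) \<le> norm S * K"
      using bounded_linear.nonneg_bounded[OF bounded_linear_predual[OF \<omega>]] by blast
    have int_h: "integrable M (h p)" for p
      unfolding h_def by (rule integrable_mult_right[OF int_\<phi>])
    have norm_h: "norm (h p s) \<le> K * norm x * g p s" for p s
    proof -
      have "norm (d (k p) o\<^sub>L x o\<^sub>L d' (l p)) \<le> norm (d (k p)) * norm x * norm (d' (l p))"
        by (rule order_trans[OF norm_blinfun_compose mult_right_mono[OF norm_blinfun_compose]]) simp
      from mult_right_mono[OF this K(1)] K(2)[of "d (k p) o\<^sub>L x o\<^sub>L d' (l p)"]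
      have "norm (\<omega> (d (k p) o\<^sub>L x o\<^sub>L d' (l p))) \<le> norm (d (k p)) * norm x * norm (d' (l p)) * K"
        by simp
      from mult_right_mono[OF this, of "norm (complex_of_real (\<phi> p s) * f s)"] show ?thesis
        by (simp add: h_def g_def norm_mult \<phi>_def mult_ac)
    qed
    have h_sum: "AE s in M. summable (\<lambda>p. norm (h p s)) \<and>
        (\<lambda>p. h p s) sums (\<omega> (\<pi> s o\<^sub>L x o\<^sub>L adj (\<pi> s)) * f s)"
      using aeE aeE'
    proof eventually_elim
      case (elim s)
      show ?case
      proof (cases "f s = 0")
        case False
        let ?a = "\<lambda>i. indicat_real (E i) s *\<^sub>R d i" and ?b = "\<lambda>j. indicat_real (E' j) s *\<^sub>R d' j"
        have ab: "(?a has_sum \<pi> s) UNIV" "(\<lambda>i. norm (?a i)) summable_on UNIV"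
          "(?b has_sum \<pi> (- s)) UNIV" "(\<lambda>i. norm (?b i)) summable_on UNIV"
          using elim False by auto
        note sw = has_sum_sandwich[OF ab bounded_linear_predual[OF \<omega>], of x]
        let ?r = "\<lambda>p. \<omega> (?a (k p) o\<^sub>L x o\<^sub>L ?b (l p))"
        have "((\<lambda>p. case prod_decode p of (i, j) \<Rightarrow> \<omega> (?a i o\<^sub>L x o\<^sub>L ?b j)) has_sum
            \<omega> (\<pi> s o\<^sub>L x o\<^sub>L \<pi> (- s))) UNIV"
          by (subst has_sum_reindex_bij_betw[OF bij_prod_decode]) (rule sw(1))
        hence "(?r has_sum \<omega> (\<pi> s o\<^sub>L x o\<^sub>L \<pi> (- s))) UNIV"
          by (simp add: k_def l_def case_prod_unfold)
        hence r: "?r sums \<omega> (\<pi> s o\<^sub>L x o\<^sub>L \<pi> (- s))" by (rule has_sum_imp_sums)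
        have "(\<lambda>p. norm (case prod_decode p of (i, j) \<Rightarrow> \<omega> (?a i o\<^sub>L x o\<^sub>L ?b j))) summable_on UNIV"
          using sw(2) by (subst summable_on_reindex_bij_betw[OF bij_prod_decode]) simp
        hence "(\<lambda>p. norm (?r p)) summable_on UNIV"
          by (simp add: k_def l_def case_prod_unfold)
        hence r': "summable (\<lambda>p. norm (?r p))" by (rule summable_on_imp_summable)
        have h: "h p s = ?r p * f s" for p
        proof -
          have "?a (k p) o\<^sub>L x o\<^sub>L ?b (l p) = \<phi> p s *\<^sub>R (d (k p) o\<^sub>L x o\<^sub>L d' (l p))"
            by (rule blinfun_eqI) (simp add: blinfun.bilinear_simps \<phi>_def indicator_inter_arith)
          thus ?thesis
            using linear_scale[OF bounded_linear.linear[OF bounded_linear_predual[OF \<omega>]]]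
            by (simp add: h_def scaleR_conv_of_real mult_ac)
        qed
        show ?thesis
          unfolding h norm_mult adj_rep using summable_mult2[OF r'] sums_mult2[OF r] by blast
      qed (simp add: h_def)
    qed
    have s1: "AE s in M. summable (\<lambda>p. norm (h p s))" using h_sum by eventually_elim simp
    have s2: "summable (\<lambda>p. LINT s|M. norm (h p s))"
    proof (rule summable_comparison_test'[OF summable_mult[OF sum_g, of "K * norm x"], where N=0])
      fix p
      have "(LINT s|M. norm (h p s)) \<le> (LINT s|M. K * norm x * g p s)"
        by (rule integral_mono) (use int_h int_g norm_h in auto)
      thus "norm (LINT s|M. norm (h p s)) \<le> K * norm x * (LINT s|M. g p s)" by simp
    qed
    have "(LINT s|M. h p s) = \<omega> (v p o\<^sub>L x o\<^sub>L w p)" for p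
      using predual_scale_op[OF \<omega>, of "c p" "d (k p) o\<^sub>L x o\<^sub>L d' (l p)"] int_\<phi>[of p]
      by (simp add: h_def[abs_def] v_def w_def c_def blinfun_compose_assoc mult.commute)
    moreover have "(LINT s|M. (\<Sum>p. h p s)) = \<omega> (Gamma_rep M \<pi> f x)"
    proof -
      \<comment> \<open>The expansions represent \<pi>(s) and \<pi>(-s) only almost everywhere on
        the set where \<open>f\<close> is nonzero, so the integrands are compared almost
        everywhere.\<close>
      have "(LINT s|M. (\<Sum>p. h p s)) = (LINT s|M. \<omega> (\<pi> s o\<^sub>L x o\<^sub>L adj (\<pi> s)) * f s)"
      proof (rule integral_cong_AE)
        show "(\<lambda>s. \<Sum>p. h p s) \<in> borel_measurable M"
          using integrable_suminf[OF int_h s1 s2] by simp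
        show "(\<lambda>s. \<omega> (\<pi> s o\<^sub>L x o\<^sub>L adj (\<pi> s)) * f s) \<in> borel_measurable M"
          using Gamma_integral(2)[OF x int \<omega>] by simp
        show "AE s in M. (\<Sum>p. h p s) = \<omega> (\<pi> s o\<^sub>L x o\<^sub>L adj (\<pi> s)) * f s"
          using h_sum by eventually_elim (auto simp: sums_iff)
      qed
      thus ?thesis using Gamma_integral(3)[OF x int \<omega>] x by (simp add: Gamma_rep_def)
    qed
    ultimately show "(\<lambda>p. \<omega> (v p o\<^sub>L x o\<^sub>L w p)) sums \<omega> (Gamma_rep M \<pi> f x)"
      using sums_integral[OF int_h s1 s2] by simp
  qed (use Cstar_bounded_ops subspace_Cstar in auto)
qed

end

text \<open>The indicator of an open set of finite measure, which has nonzero integral by positivity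
  on open sets. Condition (iii) then becomes an instance of (ii).\<close>

lemma exists_L1_not_augmentation:
  fixes M :: "'g::{topological_group_add,t2_space} measure"
  assumes lc: "locally_compact_space (euclidean :: 'g topology)" and haar: "left_haar_measure M"
  shows "\<exists>f. f \<in> L1 M - augmentation_ideal M"
proof -
  obtain U where U: "open U" "0 \<in> U" "emeasure M U < \<infinity>"
    using haar_open_finite_nhd[OF lc haar] by blast
  have pos: "emeasure M U \<noteq> 0" using U by (intro haar_open_pos[OF haar]) auto
  have sets: "U \<in> sets M" using U by (simp add: sets_haar[OF haar])
  have "integrable M (\<lambda>s. complex_of_real (indicat_real U s))"
    using U(3) sets by (intro integrable_of_real) (simp add: integrable_indicator_iff space_haar[OF haar])
  moreover have "(LINT s|M. complex_of_real (indicat_real U s)) \<noteq> 0"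
    using U(3) pos sets by (simp add: space_haar[OF haar] measure_def enn2real_eq_0_iff)
  ultimately show ?thesis by (auto simp: L1_def augmentation_ideal_def)
qed

theorem theorem3p7:
  fixes \<pi> :: "'g::{topological_group_add,t2_space} \<Rightarrow> ('h::complex_hilbert_space \<Rightarrow>\<^sub>L 'h)"
    and M :: "'g measure"
  assumes "locally_compact_space (euclidean :: 'g topology)"
    and "left_haar_measure M"
    and "unitary_rep \<pi>"
    and "strongly_continuous \<pi>"
  shows "(norm_continuous \<pi> \<longleftrightarrow> Gamma_rep M \<pi> ` L1 M \<subseteq> Cstar M \<pi> \<otimes>h Cstar M \<pi>) \<and>
         (norm_continuous \<pi> \<longleftrightarrow>
            (\<exists>f \<in> L1 M - augmentation_ideal M. Gamma_rep M \<pi> f \<in> Cstar M \<pi> \<otimes>h Cstar M \<pi>))"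
proof -
  interpret haar_unitary_rep \<pi> M by unfold_locales (use assms in auto)
  have "Gamma_rep M \<pi> ` L1 M \<subseteq> Cstar M \<pi> \<otimes>h Cstar M \<pi>" if "norm_continuous \<pi>"
    using Gamma_haagerup_if_norm_continuous[OF assms(1) that] by blast
  moreover have "\<exists>f \<in> L1 M - augmentation_ideal M. Gamma_rep M \<pi> f \<in> Cstar M \<pi> \<otimes>h Cstar M \<pi>"
    if "Gamma_rep M \<pi> ` L1 M \<subseteq> Cstar M \<pi> \<otimes>h Cstar M \<pi>"
    using that exists_L1_not_augmentation[OF assms(1,2)] by blast
  moreover have "norm_continuous \<pi>"
    if "\<exists>f \<in> L1 M - augmentation_ideal M. Gamma_rep M \<pi> f \<in> Cstar M \<pi> \<otimes>h Cstar M \<pi>"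
    using that norm_continuous_if_Gamma_haagerup by blast
  ultimately show ?thesis by blast
qed

end
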